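(* Let $X$ be an irreducible affine variety over $\mathbb{C}$ and $\mathcal{F}$ an algebraic foliation on $X$. Then the function $n_{\mathcal{F}}:X\to\mathbb{N}$, $x\mapsto \dim V(\mathcal{F},x)$, is measurable for the Zariski topology. Moreover, there exists an integer $p$ such that (1) $n_{\mathcal{F}}(x)\le p$ for every point $x\in X$, and (2) $n_{\mathcal{F}}(x)=p$ for every very generic point $x\in X$.
   Context: $\mathcal{O}_X$ denotes the ring of regular functions on $X$. An algebraic foliation $\mathcal{F}$ on $X$ is a collection of algebraic vector fields on $X$, viewed as $\mathbb{C}$-derivations of $\mathcal{O}_X$, which is stable under Lie bracket. For a Zariski closed subset $Y\subseteq X$ with vanishing ideal $I_Y\subseteq\mathcal{O}_X$, $I(\mathcal{F},Y)$ denotes the largest ideal $I$ of $\mathcal{O}_X$ such that $I\subseteq I_Y$ and $\partial(I)\subseteq I$ for all $\partial\in\mathcal{F}$ (it exists and is unique, being the sum of all such ideals). The minimal invariant variety $V(\mathcal{F},Y)$ is the zero set of $I(\mathcal{F},Y)$ in $X$; for a point $x$, $V(\mathcal{F},x):=V(\mathcal{F},\{x\})$. Let $\mathcal{M}$ be the $\sigma$-algebra on $X$ generated by the Zariski-open sets; a function $f:X\to\mathbb{N}$ is measurable for the Zariski topology if $f^{-1}(k)\in\mathcal{M}$ for all $k$. A property holds for every very generic point of $X$ if it holds at every point of some countable intersection of nonempty Zariski-open subsets of $X$. *)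

theory Defs
  imports "HOL-Analysis.Analysis"
begin

type_synonym 'n pt = "complex ^ 'n"
type_synonym 'n fn = "'n pt \<Rightarrow> complex"

text \<open>Polynomial functions on complex affine space C^n (n = CARD('n)).
  Over the infinite field C these are the same as polynomials.\<close>
inductive_set poly_fun :: "'n::finite fn set" where
  pf_const: "(\<lambda>x. c) \<in> poly_fun"
| pf_coord: "(\<lambda>x. x $ i) \<in> poly_fun"
| pf_add: "p \<in> poly_fun \<Longrightarrow> q \<in> poly_fun \<Longrightarrow> (\<lambda>x. p x + q x) \<in> poly_fun"
| pf_mult: "p \<in> poly_fun \<Longrightarrow> q \<in> poly_fun \<Longrightarrow> (\<lambda>x. p x * q x) \<in> poly_fun"

definition zariski_closed :: "'n::finite pt set \<Rightarrow> bool" where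
  "zariski_closed S \<longleftrightarrow> (\<exists>P \<subseteq> poly_fun. S = {x. \<forall>p\<in>P. p x = 0})"

definition zariski_irreducible :: "'n::finite pt set \<Rightarrow> bool" where
  "zariski_irreducible Z \<longleftrightarrow> Z \<noteq> {} \<and> zariski_closed Z \<and>
     (\<forall>A B. zariski_closed A \<longrightarrow> zariski_closed B \<longrightarrow> Z \<subseteq> A \<union> B \<longrightarrow> Z \<subseteq> A \<or> Z \<subseteq> B)"

definition irreducible_affine_variety :: "'n::finite pt set \<Rightarrow> bool" where
  "irreducible_affine_variety X \<longleftrightarrow> zariski_irreducible X"

definition zariski_opens :: "'n::finite pt set \<Rightarrow> 'n pt set set" where
  "zariski_opens X = {X - Z | Z. zariski_closed Z}"

definition zdim :: "'n::finite pt set \<Rightarrow> nat" where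
  "zdim S = Sup {k. \<exists>Z :: nat \<Rightarrow> 'n pt set.
      (\<forall>i\<le>k. zariski_irreducible (Z i) \<and> Z i \<subseteq> S) \<and> (\<forall>i<k. Z i \<subset> Z (Suc i))}"

definition regular :: "'n::finite pt set \<Rightarrow> 'n fn set" where
  "regular X = {(\<lambda>x. if x \<in> X then p x else 0) | p. p \<in> poly_fun}"

definition derivation :: "'n::finite pt set \<Rightarrow> ('n fn \<Rightarrow> 'n fn) \<Rightarrow> bool" where
  "derivation X D \<longleftrightarrow>
     (\<forall>f\<in>regular X. D f \<in> regular X) \<and>
     (\<forall>f\<in>regular X. \<forall>g\<in>regular X. D (\<lambda>x. f x + g x) = (\<lambda>x. D f x + D g x)) \<and>
     (\<forall>c. \<forall>f\<in>regular X. D (\<lambda>x. c * f x) = (\<lambda>x. c * D f x)) \<and>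
     (\<forall>f\<in>regular X. \<forall>g\<in>regular X. D (\<lambda>x. f x * g x) = (\<lambda>x. f x * D g x + g x * D f x))"

text \<open>Algebraic foliation: a set of derivations stable under the Lie bracket
  (as derivations of O_X, i.e. agreeing on O_X).\<close>
definition algebraic_foliation :: "'n::finite pt set \<Rightarrow> ('n fn \<Rightarrow> 'n fn) set \<Rightarrow> bool" where
  "algebraic_foliation X F \<longleftrightarrow> (\<forall>D\<in>F. derivation X D) \<and>
     (\<forall>D1\<in>F. \<forall>D2\<in>F. \<exists>D\<in>F. \<forall>f\<in>regular X. D f = (\<lambda>x. D1 (D2 f) x - D2 (D1 f) x))"

definition reg_ideal :: "'n::finite pt set \<Rightarrow> 'n fn set \<Rightarrow> bool" where
  "reg_ideal X I \<longleftrightarrow> I \<subseteq> regular X \<and> (\<lambda>x. 0) \<in> I \<and>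
     (\<forall>f\<in>I. \<forall>g\<in>I. (\<lambda>x. f x + g x) \<in> I) \<and>
     (\<forall>a\<in>regular X. \<forall>f\<in>I. (\<lambda>x. a x * f x) \<in> I)"

definition van_ideal :: "'n::finite pt set \<Rightarrow> 'n pt set \<Rightarrow> 'n fn set" where
  "van_ideal X Y = {f \<in> regular X. \<forall>y\<in>Y. f y = 0}"

text \<open>I(F,Y): the largest F-invariant ideal contained in I_Y (the sum, equivalently the
  union, of all such ideals, since this family is closed under sums).\<close>
definition inv_ideal :: "'n::finite pt set \<Rightarrow> ('n fn \<Rightarrow> 'n fn) set \<Rightarrow> 'n pt set \<Rightarrow> 'n fn set" where
  "inv_ideal X F Y = \<Union>{I. reg_ideal X I \<and> I \<subseteq> van_ideal X Y \<and> (\<forall>D\<in>F. D ` I \<subseteq> I)}"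

definition min_inv_variety :: "'n::finite pt set \<Rightarrow> ('n fn \<Rightarrow> 'n fn) set \<Rightarrow> 'n pt set \<Rightarrow> 'n pt set" where
  "min_inv_variety X F Y = {x \<in> X. \<forall>f\<in>inv_ideal X F Y. f x = 0}"

definition zariski_measurable :: "'n::finite pt set \<Rightarrow> ('n pt \<Rightarrow> nat) \<Rightarrow> bool" where
  "zariski_measurable X f \<longleftrightarrow> (\<forall>k. {x \<in> X. f x = k} \<in> sigma_sets X (zariski_opens X))"

definition very_generic :: "'n::finite pt set \<Rightarrow> ('n pt \<Rightarrow> bool) \<Rightarrow> bool" where
  "very_generic X P \<longleftrightarrow> (\<exists>U. countable U \<and> U \<subseteq> zariski_opens X \<and> (\<forall>V\<in>U. V \<noteq> {}) \<and>
      (\<forall>x \<in> X \<inter> \<Inter>U. P x))"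

end

theory Submission
  imports Defs "HOL-Computational_Algebra.Primes" "HOL-Computational_Algebra.Fundamental_Theorem_Algebra"
begin

text \<open>
  A polynomial restricts into \<open>I(F,x)\<close> iff all iterated derivatives of the restriction along words
  in \<open>F\<close> vanish at \<open>x\<close>. Hence, for a set \<open>S\<close> of coordinates, linear independence modulo
  \<open>I(F,x)\<close> of finitely many monomials in \<open>S\<close> says that a linear system whose coefficients are
  regular in \<open>x\<close> has trivial kernel, an open condition on \<open>x\<close>. The dimension of \<open>V(F,x)\<close> is the
  largest size of an \<open>S\<close> whose monomials are all independent modulo \<open>I(F,x)\<close>, which is a countable
  intersection of open conditions. So the strata are measurable, and \<open>p\<close> is the largest size of
  an \<open>S\<close> for which all these open sets are nonempty.

  The dimension formula has two halves. If \<open>S\<close> is independent modulo \<open>I\<close>, successive hyperplane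
  sections \<open>x\<^sub>i = c\<close> (\<open>i\<close> in \<open>S\<close>), with \<open>c\<close> avoiding bad values, give a chain of \<open>card S + 1\<close>
  primes; both this and the Nullstellensatz rest on the uncountability of the complex numbers.
  Conversely, a chain of length \<open>k\<close> gives \<open>k\<close> algebraically independent functions, so there are
  too many standard monomials for every \<open>S\<close> of size \<open>k\<close> to carry a non-standard one.
\<close>


section \<open>Polynomial functions and monomials\<close>

lemma poly_fun_sum:
  "(\<And>t. t \<in> T \<Longrightarrow> p t \<in> poly_fun) \<Longrightarrow> (\<lambda>x. \<Sum>t\<in>T. p t x) \<in> poly_fun"
proof (induction T rule: infinite_finite_induct)
  case (insert t T)
  then show ?case using pf_add[of "p t" "\<lambda>x. \<Sum>t\<in>T. p t x"] by auto
qed (auto intro: pf_const)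

lemma poly_fun_prod:
  "(\<And>t. t \<in> T \<Longrightarrow> p t \<in> poly_fun) \<Longrightarrow> (\<lambda>x. \<Prod>t\<in>T. p t x) \<in> poly_fun"
proof (induction T rule: infinite_finite_induct)
  case (insert t T)
  then show ?case using pf_mult[of "p t" "\<lambda>x. \<Prod>t\<in>T. p t x"] by auto
qed (auto intro: pf_const)

lemma poly_fun_power: "p \<in> poly_fun \<Longrightarrow> (\<lambda>x. p x ^ k) \<in> poly_fun"
  by (induction k) (auto intro: pf_const pf_mult)

lemma poly_fun_scale: "p \<in> poly_fun \<Longrightarrow> (\<lambda>x. c * p x) \<in> poly_fun"
  by (intro pf_mult pf_const)

lemma poly_fun_diff: "p \<in> poly_fun \<Longrightarrow> q \<in> poly_fun \<Longrightarrow> (\<lambda>x. p x - q x) \<in> poly_fun"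
  using pf_add[OF _ poly_fun_scale[of q "-1"], of p] by simp

lemma poly_fun_on_line:
  assumes "p \<in> poly_fun"
  shows "\<exists>P. \<forall>t. p (y + t *s (z - y)) = poly P t"
  using assms
proof induction
  case (pf_const c)
  show ?case by (rule exI[of _ "[:c:]"]) simp
next
  case (pf_coord i)
  show ?case by (rule exI[of _ "[:y $ i, z $ i - y $ i:]"]) (simp add: algebra_simps)
next
  case (pf_add p q)
  then show ?case by (metis poly_add)
next
  case (pf_mult p q)
  then show ?case by (metis poly_mult)
qed

text \<open>On the line through a point where \<open>p\<close> is nonzero and a point where
  \<open>q\<close> is nonzero, both become nonzero polynomials in one variable, whose product cannot
  vanish at every \<open>t\<close>.\<close>

lemma poly_fun_domain:
  fixes p q :: "('n::finite) fn"
  assumes "p \<in> poly_fun" "q \<in> poly_fun" "p \<noteq> (\<lambda>x. 0)" "q \<noteq> (\<lambda>x. 0)"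
  shows "(\<lambda>x. p x * q x) \<noteq> (\<lambda>x. 0)"
proof
  assume eq: "(\<lambda>x. p x * q x) = (\<lambda>x. 0)"
  obtain y z where y: "p y \<noteq> 0" and z: "q z \<noteq> 0" using assms by (metis ext)
  obtain P where P: "\<And>t. p (y + t *s (z - y)) = poly P t"
    using poly_fun_on_line[OF assms(1)] by metis
  obtain Q where Q: "\<And>t. q (y + t *s (z - y)) = poly Q t"
    using poly_fun_on_line[OF assms(2)] by metis
  have "P \<noteq> 0" using P[of 0] y by auto
  moreover have "Q \<noteq> 0" using Q[of 1] z by auto
  moreover have "poly (P * Q) t = 0" for t
    using fun_cong[OF eq, of "y + t *s (z - y)"] unfolding P Q by simp
  ultimately show False by (metis poly_all_0_iff_0 mult_eq_0_iff)
qed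

section \<open>Monomials and the order given by their weights\<close>

definition monomial_fun :: "('n::finite \<Rightarrow> nat) \<Rightarrow> 'n fn" where
  "monomial_fun a = (\<lambda>x. \<Prod>i\<in>UNIV. x $ i ^ a i)"

lemma monomial_fun_poly_fun [intro]: "monomial_fun a \<in> poly_fun"
  unfolding monomial_fun_def by (intro poly_fun_prod poly_fun_power pf_coord)

lemma monomial_fun_add: "monomial_fun (\<lambda>i. a i + b i) x = monomial_fun a x * monomial_fun b x"
  by (simp add: monomial_fun_def power_add prod.distrib)

lemma monomial_fun_zero [simp]: "monomial_fun (\<lambda>i. 0) x = 1"
  by (simp add: monomial_fun_def)

text \<open>Sending the variables to distinct primes pulls the order of the naturals back to a monomial
  order, by unique factorization.\<close>

definition var_prime :: "'n::finite \<Rightarrow> nat" where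
  "var_prime = (SOME f. inj f \<and> (\<forall>i. prime (f i)))"

lemma inj_var_prime: "inj (var_prime :: 'n::finite \<Rightarrow> nat)"
  and prime_var_prime: "prime (var_prime (i :: 'n))"
proof -
  obtain T where T: "finite T" "card T = CARD('n)" "T \<subseteq> {p::nat. prime p}"
    using infinite_arbitrarily_large[OF primes_infinite] by blast
  then obtain f :: "'n \<Rightarrow> nat" where "bij_betw f UNIV T"
    by (metis finite finite_same_card_bij)
  then have "inj f \<and> (\<forall>i. prime (f i))"
    using T by (auto simp: bij_betw_def)
  then have "inj (var_prime :: 'n \<Rightarrow> nat) \<and> (\<forall>i::'n. prime (var_prime i))"
    unfolding var_prime_def by (rule someI[where P = "\<lambda>f. inj f \<and> (\<forall>i. prime (f i))"])
  then show "inj (var_prime :: 'n \<Rightarrow> nat)" "prime (var_prime i)" by auto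
qed

definition weight :: "('n::finite \<Rightarrow> nat) \<Rightarrow> nat" where
  "weight a = (\<Prod>i\<in>UNIV. var_prime i ^ a i)"

lemma weight_add: "weight (\<lambda>i. a i + b i) = weight a * weight b"
  by (simp add: weight_def power_add prod.distrib)

lemma weight_pos [simp]: "weight a > 0"
  unfolding weight_def by (intro prod_pos zero_less_power prime_gt_0_nat prime_var_prime)

lemma inj_weight: "inj (weight :: ('n::finite \<Rightarrow> nat) \<Rightarrow> nat)"
proof (rule injI, rule ext)
  fix a b :: "'n \<Rightarrow> nat" and j
  assume eq: "weight a = weight b"
  have "multiplicity (var_prime j) (weight c) = c j" for c :: "'n \<Rightarrow> nat"
  proof -
    have "weight c = (\<Prod>p\<in>range (var_prime :: 'n \<Rightarrow> nat). p ^ c (inv var_prime p))"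
      by (simp add: weight_def prod.reindex[OF inj_var_prime] inj_var_prime)
    then have "multiplicity (var_prime j) (weight c)
        = multiplicity (var_prime j) (\<Prod>p\<in>range (var_prime :: 'n \<Rightarrow> nat). p ^ c (inv var_prime p))"
      by simp
    also have "\<dots> = c j"
      by (subst multiplicity_prod_prime_powers) (auto simp: prime_var_prime inj_var_prime)
    finally show ?thesis .
  qed
  then show "a j = b j" using eq by metis
qed

text \<open>Every variable is sent to a prime, hence to at least 2. Exponents are thus bounded
  logarithmically in the weight, as the counting of monomials requires.\<close>

lemma two_power_le_weight: "2 ^ a i \<le> weight a"
proof -
  have "weight a = var_prime i ^ a i * (\<Prod>j\<in>UNIV - {i}. var_prime j ^ a j)"
    unfolding weight_def by (rule prod.remove) auto
  moreover have "(\<Prod>j\<in>UNIV - {i}. var_prime j ^ a j) \<ge> 1"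
    by (intro prod_ge_1 one_le_power prime_ge_1_nat prime_var_prime)
  moreover have "(2::nat) ^ a i \<le> var_prime i ^ a i"
    by (intro power_mono prime_ge_2_nat prime_var_prime) simp
  ultimately show ?thesis
    by (metis le_trans mult.right_neutral mult_le_mono2)
qed

section \<open>Filtration of the polynomial functions by weight\<close>

definition level :: "nat \<Rightarrow> ('n::finite \<Rightarrow> nat) set" where
  "level N = {a. weight a \<le> N}"

lemma finite_level [simp]: "finite (level N)"
proof -
  have "finite (weight -` {..N})" by (rule finite_vimageI) (auto intro: inj_weight)
  then show ?thesis by (auto simp: level_def vimage_def)
qed

text \<open>A finite-dimensional piece of the filtration. Weights multiply, so the product of pieces
  of index \<open>N\<close> and \<open>M\<close> lies in the piece of index \<open>N * M\<close>,
  not \<open>N + M\<close>.\<close>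

definition poly_level :: "nat \<Rightarrow> ('n::finite) fn set" where
  "poly_level N = {\<lambda>x. \<Sum>a\<in>level N. u a * monomial_fun a x | u. True}"

lemma poly_levelI: "p = (\<lambda>x. \<Sum>a\<in>level N. u a * monomial_fun a x) \<Longrightarrow> p \<in> poly_level N"
  by (auto simp: poly_level_def)

lemma poly_level_add:
  "p \<in> poly_level N \<Longrightarrow> q \<in> poly_level N \<Longrightarrow> (\<lambda>x. p x + q x) \<in> poly_level N"
proof -
  assume "p \<in> poly_level N" "q \<in> poly_level N"
  then obtain u v where "p = (\<lambda>x. \<Sum>a\<in>level N. u a * monomial_fun a x)"
    "q = (\<lambda>x. \<Sum>a\<in>level N. v a * monomial_fun a x)" by (auto simp: poly_level_def)
  then show ?thesis
    by (intro poly_levelI[where u = "\<lambda>a. u a + v a"]) (simp add: sum.distrib distrib_right)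
qed

lemma poly_level_scale: "p \<in> poly_level N \<Longrightarrow> (\<lambda>x. c * p x) \<in> poly_level N"
proof -
  assume "p \<in> poly_level N"
  then obtain u where "p = (\<lambda>x. \<Sum>a\<in>level N. u a * monomial_fun a x)" by (auto simp: poly_level_def)
  then show ?thesis
    by (intro poly_levelI[where u = "\<lambda>a. c * u a"]) (simp add: sum_distrib_left mult.assoc)
qed

lemma poly_level_monomial:
  assumes "a \<in> level N"
  shows "monomial_fun a \<in> poly_level N"
proof (rule poly_levelI[where u = "\<lambda>b. of_bool (b = a)"], rule ext)
  fix x
  have "(\<Sum>b\<in>level N. of_bool (b = a) * monomial_fun b x)
      = (\<Sum>b\<in>level N. if b = a then monomial_fun b x else 0)"
    by (rule sum.cong) auto
  then show "monomial_fun a x = (\<Sum>b\<in>level N. of_bool (b = a) * monomial_fun b x)"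
    using assms by simp
qed

lemma poly_level_zero: "(\<lambda>x. 0) \<in> poly_level N"
  by (rule poly_levelI[where u = "\<lambda>b. 0"]) simp

lemma poly_level_sum:
  "(\<And>t. t \<in> T \<Longrightarrow> p t \<in> poly_level N) \<Longrightarrow> (\<lambda>x. \<Sum>t\<in>T. p t x) \<in> poly_level N"
proof (induction T rule: infinite_finite_induct)
  case (insert t T)
  then show ?case using poly_level_add[of "p t" N "\<lambda>x. \<Sum>t\<in>T. p t x"] by auto
qed (auto intro: poly_level_zero)

lemma poly_level_mono: "N \<le> M \<Longrightarrow> poly_level N \<subseteq> poly_level M"
proof
  fix p :: "('n::finite) fn" assume "N \<le> M" "p \<in> poly_level N"
  then obtain u where "p = (\<lambda>x. \<Sum>a\<in>level N. u a * monomial_fun a x)" by (auto simp: poly_level_def)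
  moreover have "(\<lambda>x. \<Sum>a\<in>level N. u a * monomial_fun a x) \<in> poly_level M"
    using \<open>N \<le> M\<close> by (intro poly_level_sum poly_level_scale poly_level_monomial) (auto simp: level_def)
  ultimately show "p \<in> poly_level M" by simp
qed

lemma poly_level_mult:
  assumes "p \<in> poly_level N" "q \<in> poly_level M"
  shows "(\<lambda>x. p x * q x) \<in> poly_level (N * M)"
proof -
  obtain u v where "p = (\<lambda>x. \<Sum>a\<in>level N. u a * monomial_fun a x)"
    "q = (\<lambda>x. \<Sum>a\<in>level M. v a * monomial_fun a x)" using assms by (auto simp: poly_level_def)
  then have "(\<lambda>x. p x * q x) = (\<lambda>x. \<Sum>a\<in>level N. \<Sum>b\<in>level M.
      (u a * v b) * monomial_fun (\<lambda>i. a i + b i) x)"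
    by (simp add: sum_product monomial_fun_add mult_ac)
  also have "\<dots> \<in> poly_level (N * M)"
    by (intro poly_level_sum poly_level_scale poly_level_monomial)
      (auto simp: level_def weight_add intro: mult_le_mono)
  finally show ?thesis .
qed

lemma poly_level_one: "(\<lambda>x. 1) \<in> (poly_level 1 :: ('n::finite) fn set)"
proof -
  have "(monomial_fun (\<lambda>i. 0) :: 'n fn) \<in> poly_level 1"
    by (rule poly_level_monomial) (simp add: level_def weight_def)
  moreover have "(monomial_fun (\<lambda>i. 0) :: 'n fn) = (\<lambda>x. 1)" by (rule ext) simp
  ultimately show ?thesis by simp
qed

lemma poly_level_power: "p \<in> poly_level M \<Longrightarrow> (\<lambda>x. p x ^ e) \<in> poly_level (M ^ e)"
  by (induction e) (auto intro: poly_level_mult poly_level_one[simplified])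

lemma poly_level_poly_fun: "poly_level N \<subseteq> poly_fun"
  by (auto simp: poly_level_def intro!: poly_fun_sum poly_fun_scale)

text \<open>The pieces exhaust the polynomial functions, which therefore have countable dimension
  over the complex numbers.\<close>

lemma poly_fun_poly_level:
  assumes "p \<in> poly_fun"
  shows "\<exists>N. p \<in> poly_level N"
  using assms
proof induction
  case (pf_const c)
  have "(\<lambda>x. c) \<in> poly_level 1" using poly_level_scale[OF poly_level_one, of c] by simp
  then show ?case by blast
next
  case (pf_coord i)
  have "(\<lambda>x. x $ i) = monomial_fun (\<lambda>j. if j = i then 1 else 0)"
    by (simp add: monomial_fun_def if_distrib cong: if_cong)
  also have "\<dots> \<in> poly_level (weight (\<lambda>j. if j = i then 1 else 0))"
    by (rule poly_level_monomial) (simp add: level_def)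
  finally show ?case by blast
next
  case (pf_add p q)
  then obtain N M where "p \<in> poly_level N" "q \<in> poly_level M" by blast
  then have "p \<in> poly_level (max N M)" "q \<in> poly_level (max N M)"
    using poly_level_mono by (meson max.cobounded1 max.cobounded2 subsetD)+
  then show ?case using poly_level_add by blast
next
  case (pf_mult p q)
  then show ?case using poly_level_mult by blast
qed

section \<open>Linear algebra\<close>

text \<open>Gaussian elimination, one equation \<open>b\<close> at a time: a pivot unknown
  \<open>a0\<close> is removed together with \<open>b\<close>, so unknowns still outnumber
  equations.\<close>

lemma underdetermined_system:
  fixes c :: "'a \<Rightarrow> 'b \<Rightarrow> 'k::field"
  assumes "finite B" "finite A" "card B < card A"
  shows "\<exists>u. (\<exists>a\<in>A. u a \<noteq> 0) \<and> (\<forall>b\<in>B. (\<Sum>a\<in>A. u a * c a b) = 0)"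
  using assms
proof (induction B arbitrary: A c rule: finite_induct)
  case empty
  then obtain a where "a \<in> A" by fastforce
  then show ?case by (intro exI[of _ "\<lambda>_. 1"]) auto
next
  case (insert b B)
  show ?case
  proof (cases "\<forall>a\<in>A. c a b = 0")
    case True
    have "card B < card A" using insert by simp
    from insert.IH[OF insert.prems(1) this, of c] True show ?thesis by auto
  next
    case False
    then obtain a0 where a0: "a0 \<in> A" "c a0 b \<noteq> 0" by blast
    let ?A = "A - {a0}"
    define c' where "c' a b' = c a b' - c a b / c a0 b * c a0 b'" for a b'
    have "card B < card ?A" using insert a0 by (simp add: card_Diff_singleton)
    from insert.IH[OF _ this, of c'] insert.prems obtain u where
      u: "\<exists>a\<in>?A. u a \<noteq> 0" "\<And>b'. b' \<in> B \<Longrightarrow> (\<Sum>a\<in>?A. u a * c' a b') = 0" by auto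
    define s where "s = - (\<Sum>a\<in>?A. u a * c a b) / c a0 b"
    define v where "v = u(a0 := s)"
    have split: "(\<Sum>a\<in>A. v a * c a b') = s * c a0 b' + (\<Sum>a\<in>?A. u a * c a b')" for b'
      using sum.remove[OF insert.prems(1) a0(1), of "\<lambda>a. v a * c a b'"] by (simp add: v_def)
    have "(\<Sum>a\<in>A. v a * c a b) = 0" unfolding split s_def using a0 by simp
    moreover have "(\<Sum>a\<in>A. v a * c a b') = 0" if "b' \<in> B" for b'
    proof -
      have "0 = (\<Sum>a\<in>?A. u a * c a b') - (\<Sum>a\<in>?A. u a * c a b) / c a0 b * c a0 b'"
        using u(2)[OF that] by (simp add: c'_def algebra_simps sum_subtractf sum_distrib_left sum_divide_distrib)
      then show ?thesis unfolding split s_def by simp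
    qed
    moreover have "\<exists>a\<in>A. v a \<noteq> 0" using u(1) by (auto simp: v_def)
    ultimately show ?thesis by auto
  qed
qed


section \<open>Ideals and the Nullstellensatz\<close>

definition poly_ideal :: "('n::finite) fn set \<Rightarrow> bool" where
  "poly_ideal I \<longleftrightarrow> I \<subseteq> poly_fun \<and> (\<lambda>x. 0) \<in> I \<and>
     (\<forall>p\<in>I. \<forall>q\<in>I. (\<lambda>x. p x + q x) \<in> I) \<and>
     (\<forall>p\<in>poly_fun. \<forall>q\<in>I. (\<lambda>x. p x * q x) \<in> I)"

definition poly_prime :: "('n::finite) fn set \<Rightarrow> bool" where
  "poly_prime Q \<longleftrightarrow> poly_ideal Q \<and> (\<lambda>x. 1) \<notin> Q \<and>
     (\<forall>p\<in>poly_fun. \<forall>q\<in>poly_fun. (\<lambda>x. p x * q x) \<in> Q \<longrightarrow> p \<in> Q \<or> q \<in> Q)"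

definition zeros :: "('n::finite) fn set \<Rightarrow> 'n pt set" where
  "zeros I = {x. \<forall>p\<in>I. p x = 0}"

lemma poly_idealD:
  assumes "poly_ideal I"
  shows poly_ideal_subset: "I \<subseteq> poly_fun"
    and poly_ideal_zero: "(\<lambda>x. 0) \<in> I"
    and poly_ideal_add: "\<And>p q. p \<in> I \<Longrightarrow> q \<in> I \<Longrightarrow> (\<lambda>x. p x + q x) \<in> I"
    and poly_ideal_mult: "\<And>p q. p \<in> poly_fun \<Longrightarrow> q \<in> I \<Longrightarrow> (\<lambda>x. p x * q x) \<in> I"
  using assms by (auto simp: poly_ideal_def)

lemma poly_ideal_scale: "poly_ideal I \<Longrightarrow> p \<in> I \<Longrightarrow> (\<lambda>x. c * p x) \<in> I"
  using poly_ideal_mult[OF _ pf_const] by blast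

lemma poly_ideal_diff: "poly_ideal I \<Longrightarrow> p \<in> I \<Longrightarrow> q \<in> I \<Longrightarrow> (\<lambda>x. p x - q x) \<in> I"
  using poly_ideal_add[of I p "\<lambda>x. (-1) * q x"] poly_ideal_scale[of I q "-1"] by simp

lemma poly_ideal_sum:
  "poly_ideal I \<Longrightarrow> (\<And>t. t \<in> T \<Longrightarrow> p t \<in> I) \<Longrightarrow> (\<lambda>x. \<Sum>t\<in>T. p t x) \<in> I"
proof (induction T rule: infinite_finite_induct)
  case (insert t T)
  then show ?case using poly_ideal_add[of I "p t" "\<lambda>x. \<Sum>t\<in>T. p t x"] by auto
qed (auto intro: poly_ideal_zero)

lemma poly_primeD:
  assumes "poly_prime Q"
  shows poly_prime_ideal: "poly_ideal Q"
    and poly_prime_one: "(\<lambda>x. 1) \<notin> Q"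
    and poly_prime_mult: "\<And>p q. (\<lambda>x. p x * q x) \<in> Q \<Longrightarrow> p \<in> poly_fun \<Longrightarrow> q \<in> poly_fun \<Longrightarrow> p \<in> Q \<or> q \<in> Q"
  using assms by (auto simp: poly_prime_def)

lemma poly_prime_const: "poly_prime Q \<Longrightarrow> (\<lambda>x. c) \<in> Q \<Longrightarrow> c = 0"
  using poly_ideal_scale[OF poly_prime_ideal, of Q "\<lambda>x. c" "1 / c"] poly_prime_one[of Q]
  by (cases "c = 0") auto

text \<open>For an ideal \<open>I\<close> and a polynomial function \<open>f\<close>, the ideal
  generated by both.\<close>

definition ideal_adjoin :: "('n::finite) fn set \<Rightarrow> 'n fn \<Rightarrow> 'n fn set" where
  "ideal_adjoin I f = {\<lambda>x. p x + q x * f x | p q. p \<in> I \<and> q \<in> poly_fun}"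

lemma ideal_adjoinI:
  "p \<in> I \<Longrightarrow> q \<in> poly_fun \<Longrightarrow> g = (\<lambda>x. p x + q x * f x) \<Longrightarrow> g \<in> ideal_adjoin I f"
  unfolding ideal_adjoin_def by blast

lemma ideal_adjoinE:
  fixes g :: "('n::finite) fn"
  assumes "g \<in> ideal_adjoin I f"
  obtains p q where "p \<in> I" "q \<in> poly_fun" "g = (\<lambda>x. p x + q x * f x)"
  using assms unfolding ideal_adjoin_def by blast

lemma ideal_adjoin:
  fixes f :: "('n::finite) fn"
  assumes "poly_ideal I" "f \<in> poly_fun"
  shows poly_ideal_adjoin: "poly_ideal (ideal_adjoin I f)"
    and ideal_adjoin_subset: "I \<subseteq> ideal_adjoin I f"
    and ideal_adjoin_mem: "f \<in> ideal_adjoin I f"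
proof -
  show "poly_ideal (ideal_adjoin I f)"
    unfolding poly_ideal_def
  proof (intro conjI ballI)
    show "ideal_adjoin I f \<subseteq> poly_fun"
      using poly_ideal_subset[OF assms(1)] assms(2)
      by (auto simp: ideal_adjoin_def intro!: pf_add pf_mult)
    show "(\<lambda>x. 0) \<in> ideal_adjoin I f"
      by (rule ideal_adjoinI[OF poly_ideal_zero[OF assms(1)] pf_const[of 0]]) simp
  next
    fix g h :: "'n fn" assume "g \<in> ideal_adjoin I f" "h \<in> ideal_adjoin I f"
    obtain p q where g: "p \<in> I" "q \<in> poly_fun" "g = (\<lambda>x. p x + q x * f x)"
      using \<open>g \<in> _\<close> by (rule ideal_adjoinE)
    obtain p' q' where h: "p' \<in> I" "q' \<in> poly_fun" "h = (\<lambda>x. p' x + q' x * f x)"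
      using \<open>h \<in> _\<close> by (rule ideal_adjoinE)
    have "(\<lambda>x. g x + h x) = (\<lambda>x. (p x + p' x) + (q x + q' x) * f x)"
      by (simp add: g(3) h(3) algebra_simps)
    moreover have "(\<lambda>x. p x + p' x) \<in> I" "(\<lambda>x. q x + q' x) \<in> poly_fun"
      using g h assms by (auto intro: poly_ideal_add pf_add)
    ultimately show "(\<lambda>x. g x + h x) \<in> ideal_adjoin I f" by (intro ideal_adjoinI)
  next
    fix g h :: "'n fn" assume "g \<in> poly_fun" "h \<in> ideal_adjoin I f"
    obtain p q where h: "p \<in> I" "q \<in> poly_fun" "h = (\<lambda>x. p x + q x * f x)"
      using \<open>h \<in> _\<close> by (rule ideal_adjoinE)
    have "(\<lambda>x. g x * h x) = (\<lambda>x. (g x * p x) + (g x * q x) * f x)"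
      by (simp add: h(3) algebra_simps)
    moreover have "(\<lambda>x. g x * p x) \<in> I" "(\<lambda>x. g x * q x) \<in> poly_fun"
      using h assms \<open>g \<in> poly_fun\<close> by (auto intro: poly_ideal_mult pf_mult)
    ultimately show "(\<lambda>x. g x * h x) \<in> ideal_adjoin I f" by (intro ideal_adjoinI)
  qed
  show "I \<subseteq> ideal_adjoin I f"
  proof
    fix p assume "p \<in> I"
    then show "p \<in> ideal_adjoin I f" by (rule ideal_adjoinI[OF _ pf_const[of 0]]) simp
  qed
  show "f \<in> ideal_adjoin I f"
    by (rule ideal_adjoinI[OF poly_ideal_zero[OF assms(1)] pf_const[of 1]]) simp
qed

text \<open>An ideal maximal among those containing \<open>I\<close> and missing the multiplicative
  set \<open>M\<close> is prime: if \<open>p\<close> and \<open>q\<close> lie outside it, adjoining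
  either one meets \<open>M\<close>, and the product of the two elements of \<open>M\<close> would
  lie in the ideal as soon as \<open>p q\<close> does. Maximality is exported as the last conclusion
  for the Nullstellensatz.\<close>

lemma prime_avoiding:
  assumes I: "poly_ideal I" and M: "M \<subseteq> poly_fun" "(\<lambda>x. 1) \<in> M"
    and M_mult: "\<And>p q. p \<in> M \<Longrightarrow> q \<in> M \<Longrightarrow> (\<lambda>x. p x * q x) \<in> M"
    and disj: "I \<inter> M = {}"
  obtains Q where "poly_prime Q" "I \<subseteq> Q" "Q \<inter> M = {}"
    "\<And>f. f \<in> poly_fun \<Longrightarrow> f \<notin> Q \<Longrightarrow> ideal_adjoin Q f \<inter> M \<noteq> {}"
proof -
  let ?A = "{J. poly_ideal J \<and> I \<subseteq> J \<and> J \<inter> M = {}}"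
  have "\<exists>Q\<in>?A. \<forall>J\<in>?A. Q \<subseteq> J \<longrightarrow> J = Q"
  proof (rule subset_Zorn_nonempty)
    show "?A \<noteq> {}" using I disj by auto
  next
    fix C assume C: "C \<noteq> {}" "subset.chain ?A C"
    have sub: "C \<subseteq> ?A" using C(2) by (auto simp: subset.chain_def)
    have comparable: "J \<subseteq> K \<or> K \<subseteq> J" if "J \<in> C" "K \<in> C" for J K
      using C(2) that by (auto simp: subset_chain_def)
    have "poly_ideal (\<Union>C)"
      unfolding poly_ideal_def
    proof (intro conjI ballI)
      show "\<Union>C \<subseteq> poly_fun" using sub poly_ideal_subset by fastforce
      show "(\<lambda>x. 0) \<in> \<Union>C" using sub C(1) poly_ideal_zero by fastforce
    next
      fix p q assume "p \<in> \<Union>C" "q \<in> \<Union>C"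
      then obtain J where "J \<in> C" "p \<in> J" "q \<in> J" using comparable by blast
      then show "(\<lambda>x. p x + q x) \<in> \<Union>C" using sub poly_ideal_add by blast
    next
      fix p q :: "'a fn" assume "p \<in> poly_fun" "q \<in> \<Union>C"
      then show "(\<lambda>x. p x * q x) \<in> \<Union>C" using sub poly_ideal_mult by blast
    qed
    then show "\<Union>C \<in> ?A" using sub C(1) by blast
  qed
  then obtain Q where QA: "Q \<in> ?A" and maxA: "\<forall>J\<in>?A. Q \<subseteq> J \<longrightarrow> J = Q" by (rule bexE)
  have Q: "poly_ideal Q" "I \<subseteq> Q" "Q \<inter> M = {}" using QA by simp_all
  have max: "J = Q" if "poly_ideal J" "Q \<subseteq> J" "J \<inter> M = {}" for J
    using bspec[OF maxA, of J] that Q(2) by auto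
  have adj: "ideal_adjoin Q f \<inter> M \<noteq> {}" if f: "f \<in> poly_fun" "f \<notin> Q" for f
  proof
    assume "ideal_adjoin Q f \<inter> M = {}"
    then have "ideal_adjoin Q f = Q"
      by (rule max[OF poly_ideal_adjoin[OF Q(1) f(1)] ideal_adjoin_subset[OF Q(1) f(1)]])
    then show False using ideal_adjoin_mem[OF Q(1) f(1)] f(2) by simp
  qed
  have "p \<in> Q \<or> q \<in> Q"
    if pq: "p \<in> poly_fun" "q \<in> poly_fun" "(\<lambda>x. p x * q x) \<in> Q" for p q
  proof (rule ccontr)
    assume "\<not> (p \<in> Q \<or> q \<in> Q)"
    then have "ideal_adjoin Q p \<inter> M \<noteq> {}" "ideal_adjoin Q q \<inter> M \<noteq> {}"
      using adj pq(1,2) by simp_all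
    then obtain m m' where "m \<in> M" "m' \<in> M"
      and mem: "m \<in> ideal_adjoin Q p" "m' \<in> ideal_adjoin Q q" by fast
    obtain a b where m: "a \<in> Q" "b \<in> poly_fun" "m = (\<lambda>x. a x + b x * p x)"
      using mem(1) by (rule ideal_adjoinE)
    obtain a' b' where m': "a' \<in> Q" "b' \<in> poly_fun" "m' = (\<lambda>x. a' x + b' x * q x)"
      using mem(2) by (rule ideal_adjoinE)
    have "m' \<in> poly_fun" using \<open>m' \<in> M\<close> M by auto
    have "(\<lambda>x. m x * m' x) = (\<lambda>x. (m' x * a x + (b x * p x) * a' x) + (b x * b' x) * (p x * q x))"
      by (simp add: m(3) m'(3) algebra_simps)
    also have "\<dots> \<in> Q"
      by (intro poly_ideal_add[OF Q(1)] poly_ideal_mult[OF Q(1) \<open>m' \<in> poly_fun\<close> m(1)]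
          poly_ideal_mult[OF Q(1) pf_mult[OF m(2) pq(1)] m'(1)]
          poly_ideal_mult[OF Q(1) pf_mult[OF m(2) m'(2)] pq(3)])
    finally show False using M_mult[OF \<open>m \<in> M\<close> \<open>m' \<in> M\<close>] Q by auto
  qed
  moreover have "(\<lambda>x. 1) \<notin> Q" using Q(3) M(2) by blast
  ultimately have "poly_prime Q" using Q(1) unfolding poly_prime_def by simp
  then show ?thesis using Q(2,3) adj by (rule that)
qed

text \<open>Polynomials form a vector space of countable dimension, while the scalars are uncountable.\<close>

lemma dependent_uncountable_family:
  fixes q :: "complex \<Rightarrow> ('n::finite) fn" and m :: "complex \<Rightarrow> nat"
  assumes q: "\<And>c. q c \<in> poly_fun"
  obtains C k b where "finite C" "\<And>c. c \<in> C \<Longrightarrow> m c = k" "\<exists>c\<in>C. b c \<noteq> 0"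
    "\<And>x. (\<Sum>c\<in>C. b c * q c x) = 0"
proof -
  \<comment> \<open>Countably many classes, indexed by label and level, cover the uncountable field,
    so one class is uncountable.\<close>
  define E where "E = (\<lambda>(k, N). {c. m c = k \<and> q c \<in> poly_level N})"
  have "(\<Union>z. E z) = UNIV" using poly_fun_poly_level[OF q] by (auto simp: E_def)
  moreover have "uncountable (UNIV :: complex set)" by (rule uncountable_UNIV_complex)
  ultimately obtain z where "uncountable (E z)" by (metis countable_UN countableI_type)
  then obtain k N where "uncountable (E (k, N))" by (cases z) auto
  then have "infinite (E (k, N))" using countable_finite by blast
  \<comment> \<open>One function more than there are monomials in \<open>level N\<close> forces a
    linear dependence.\<close>
  then obtain C where C: "finite C" "card C = Suc (card (level N :: ('n \<Rightarrow> nat) set))" "C \<subseteq> E (k, N)"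
    using infinite_arbitrarily_large by blast
  then have "\<exists>u. q c = (\<lambda>x. \<Sum>a\<in>level N. u a * monomial_fun a x)" if "c \<in> C" for c
    using that by (auto simp: E_def poly_level_def)
  then obtain u where u: "\<And>c. c \<in> C \<Longrightarrow> q c = (\<lambda>x. \<Sum>a\<in>level N. u c a * monomial_fun a x)"
    by metis
  obtain b where b: "\<exists>c\<in>C. b c \<noteq> 0" "\<And>a. a \<in> level N \<Longrightarrow> (\<Sum>c\<in>C. b c * u c a) = 0"
    using underdetermined_system[of "level N" C u] C by auto
  have "(\<Sum>c\<in>C. b c * q c x) = 0" for x
  proof -
    have "(\<Sum>c\<in>C. b c * q c x) = (\<Sum>c\<in>C. \<Sum>a\<in>level N. b c * u c a * monomial_fun a x)"
      using u by (simp add: sum_distrib_left mult.assoc)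
    also have "\<dots> = (\<Sum>a\<in>level N. (\<Sum>c\<in>C. b c * u c a) * monomial_fun a x)"
      by (subst sum.swap) (simp add: sum_distrib_right)
    finally show ?thesis using b by simp
  qed
  with C b(1) show ?thesis by (intro that[of C k b]) (auto simp: E_def)
qed

text \<open>If every \<open>x\<^sub>i - c\<close> is invertible modulo \<open>Q\<close> up to the factor \<open>r c\<close>, then clearing
  denominators in a linear relation between the inverses gives an element of \<open>Q\<close>.\<close>

lemma clear_denominators:
  assumes Q: "poly_ideal Q" and C: "finite C" and q: "\<And>c. c \<in> C \<Longrightarrow> q c \<in> poly_fun"
    and inv: "\<And>c. c \<in> C \<Longrightarrow> (\<lambda>x. r c x - q c x * (x $ i - c)) \<in> Q"
    and rel: "\<And>x. (\<Sum>c\<in>C. b c * q c x) = 0"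
  shows "(\<lambda>x. \<Sum>c\<in>C. b c * r c x * (\<Prod>d\<in>C - {c}. x $ i - d)) \<in> Q"
proof -
  have eq: "(\<Sum>c\<in>C. b c * r c x * (\<Prod>d\<in>C - {c}. x $ i - d))
      = (\<Sum>c\<in>C. (b c * (\<Prod>d\<in>C - {c}. x $ i - d)) * (r c x - q c x * (x $ i - c)))" for x
  proof -
    \<comment> \<open>Times its missing factor, the product over \<open>C - {c}\<close> becomes the
      product over all of \<open>C\<close>, which factors out and leaves the relation
      \<open>rel\<close>.\<close>
    have "(\<Sum>c\<in>C. b c * q c x * ((x $ i - c) * (\<Prod>d\<in>C - {c}. x $ i - d)))
        = (\<Sum>c\<in>C. b c * q c x * (\<Prod>d\<in>C. x $ i - d))"
      by (rule sum.cong) (simp_all add: prod.remove[OF C])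
    also have "\<dots> = 0" by (simp add: rel flip: sum_distrib_right)
    finally show ?thesis by (simp add: algebra_simps sum_subtractf sum.distrib)
  qed
  have "(\<lambda>x. (b c * (\<Prod>d\<in>C - {c}. x $ i - d)) * (r c x - q c x * (x $ i - c))) \<in> Q"
    if "c \<in> C" for c
    by (intro poly_ideal_mult[OF Q _ inv[OF that]] poly_fun_scale poly_fun_prod poly_fun_diff
        pf_coord pf_const)
  then show ?thesis unfolding eq by (rule poly_ideal_sum[OF Q])
qed

text \<open>A nonzero polynomial splits into linear factors over the complex numbers; a prime ideal
  contains one of them, as the constant left over is invertible.\<close>

lemma prime_contains_linear_factor:
  assumes Q: "poly_prime Q" and "(\<lambda>x. poly P (x $ i)) \<in> Q" "P \<noteq> 0"
  shows "\<exists>e. (\<lambda>x. x $ i - e) \<in> Q"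
  using assms(2,3)
proof (induction "degree P" arbitrary: P)
  case 0
  then obtain c where "P = [:c:]" "c \<noteq> 0" by (metis degree_eq_zeroE pCons_0_0)
  with 0 poly_prime_const[OF Q, of c] show ?case by simp
next
  case (Suc n)
  then have "\<not> constant (poly P)" by (simp add: constant_degree)
  then obtain e where "poly P e = 0" using fundamental_theorem_of_algebra by blast
  then obtain R where R: "P = [:-e, 1:] * R" by (metis poly_eq_0_iff_dvd dvdE)
  have "R \<noteq> 0" using R Suc.prems by auto
  then have deg: "degree P = Suc (degree R)" unfolding R by (subst degree_mult_eq) auto
  have poly_eval: "(\<lambda>x. poly R (x $ i)) \<in> poly_fun"
    unfolding poly_altdef by (intro poly_fun_sum poly_fun_scale poly_fun_power pf_coord)
  have "(\<lambda>x. (x $ i - e) * poly R (x $ i)) \<in> Q"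
    using Suc.prems(1) unfolding R by (simp add: algebra_simps)
  then have "(\<lambda>x. x $ i - e) \<in> Q \<or> (\<lambda>x. poly R (x $ i)) \<in> Q"
    by (rule poly_prime_mult[OF Q]) (auto intro: poly_eval poly_fun_diff pf_coord pf_const)
  then show ?case using Suc.hyps deg \<open>R \<noteq> 0\<close> by auto
qed

text \<open>An ideal \<open>R\<close> over \<open>Q\<close>, maximal among those containing no power
  of \<open>f\<close>, turns out to be the ideal of a point \<open>y\<close>. If no
  \<open>x $ i - c\<close> were in \<open>R\<close>, each would be invertible modulo
  \<open>R\<close> up to a power of \<open>f\<close>, and a linear relation among these uncountably
  many inverses would produce a nonzero polynomial in \<open>x $ i\<close> inside
  \<open>R\<close>.\<close>

lemma prime_nullstellensatz:
  fixes f :: "('n::finite) fn"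
  assumes Q: "poly_prime Q" and f: "f \<in> poly_fun" "f \<notin> Q"
  obtains y where "y \<in> zeros Q" "f y \<noteq> 0"
proof -
  define M where "M = {\<lambda>x. f x ^ k | k. True}"
  have M: "M \<subseteq> poly_fun" "(\<lambda>x. 1) \<in> M" "f \<in> M"
  proof -
    show "M \<subseteq> poly_fun" using poly_fun_power[OF f(1)] by (auto simp: M_def)
    have "(\<lambda>x. f x ^ 0) \<in> M" "(\<lambda>x. f x ^ 1) \<in> M" unfolding M_def by blast+
    then show "(\<lambda>x. 1) \<in> M" "f \<in> M" by simp_all
  qed
  have M_mult: "(\<lambda>x. p x * q x) \<in> M" if "p \<in> M" "q \<in> M" for p q
    using that by (auto simp: M_def power_add[symmetric])
  have "(\<lambda>x. f x ^ k) \<notin> Q" for k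
  proof (induction k)
    case 0
    then show ?case using poly_prime_one[OF Q] by simp
  next
    case (Suc k)
    then show ?case using poly_prime_mult[OF Q, of f "\<lambda>x. f x ^ k"] f poly_fun_power[OF f(1)] by auto
  qed
  then have "Q \<inter> M = {}" by (auto simp: M_def)
  then obtain R where R: "poly_prime R" "Q \<subseteq> R" "R \<inter> M = {}"
    and adj: "\<And>g. g \<in> poly_fun \<Longrightarrow> g \<notin> R \<Longrightarrow> ideal_adjoin R g \<inter> M \<noteq> {}"
    using prime_avoiding[OF poly_prime_ideal[OF Q] M(1,2) M_mult] by blast
  note idR = poly_prime_ideal[OF R(1)]
  have "\<exists>c. (\<lambda>x. x $ i - c) \<in> R" for i
  proof (rule ccontr)
    assume none: "\<nexists>c. (\<lambda>x. x $ i - c) \<in> R"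
    have "\<forall>c. \<exists>q k. q \<in> poly_fun \<and> (\<lambda>x. f x ^ k - q x * (x $ i - c)) \<in> R"
    proof
      fix c
      have "ideal_adjoin R (\<lambda>x. x $ i - c) \<inter> M \<noteq> {}"
        using none by (intro adj poly_fun_diff pf_coord pf_const) auto
      then obtain k where "(\<lambda>x. f x ^ k) \<in> ideal_adjoin R (\<lambda>x. x $ i - c)" by (auto simp: M_def)
      then obtain p q where *: "p \<in> R" "q \<in> poly_fun" "(\<lambda>x. f x ^ k) = (\<lambda>x. p x + q x * (x $ i - c))"
        by (rule ideal_adjoinE)
      have "(\<lambda>x. f x ^ k - q x * (x $ i - c)) = p"
        using fun_cong[OF *(3)] by (intro ext) (simp add: algebra_simps)
      then have "q \<in> poly_fun \<and> (\<lambda>x. f x ^ k - q x * (x $ i - c)) \<in> R" using * by simp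
      then show "\<exists>q k. q \<in> poly_fun \<and> (\<lambda>x. f x ^ k - q x * (x $ i - c)) \<in> R" by (intro exI)
    qed
    from this[unfolded choice_iff]
    obtain q m where qm: "\<forall>c. q c \<in> poly_fun \<and> (\<lambda>x. f x ^ m c - q c x * (x $ i - c)) \<in> R"
      by (elim exE)
    have q: "q c \<in> poly_fun" "(\<lambda>x. f x ^ m c - q c x * (x $ i - c)) \<in> R" for c
      using spec[OF qm, of c] by simp_all
    \<comment> \<open>Labelling by exponent makes all chosen \<open>c\<close> share one power
      \<open>f ^ k\<close>, which is factored out below.\<close>
    obtain C k b where C: "finite C" "\<And>c. c \<in> C \<Longrightarrow> m c = k" "\<exists>c\<in>C. b c \<noteq> 0"
      "\<And>x. (\<Sum>c\<in>C. b c * q c x) = 0"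
      by (rule dependent_uncountable_family[of q m, OF q(1)]) (rule that)
    define P where "P = (\<Sum>c\<in>C. [:b c:] * (\<Prod>d\<in>C - {c}. [:-d, 1:]))"
    have poly_P: "poly P t = (\<Sum>c\<in>C. b c * (\<Prod>d\<in>C - {c}. t - d))" for t
      by (simp add: P_def poly_sum poly_prod)
    have "(\<lambda>x. \<Sum>c\<in>C. b c * f x ^ m c * (\<Prod>d\<in>C - {c}. x $ i - d)) \<in> R"
      using clear_denominators[OF idR C(1) q(1) q(2) C(4)] .
    moreover have "(\<lambda>x. \<Sum>c\<in>C. b c * f x ^ m c * (\<Prod>d\<in>C - {c}. x $ i - d))
        = (\<lambda>x. f x ^ k * poly P (x $ i))"
      unfolding poly_P sum_distrib_left
      by (intro ext sum.cong refl) (simp add: C(2) mult_ac)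
    ultimately have "(\<lambda>x. f x ^ k * poly P (x $ i)) \<in> R" by simp
    moreover have "(\<lambda>x. f x ^ k) \<notin> R" using R(3) by (auto simp: M_def)
    moreover have "(\<lambda>x. poly P (x $ i)) \<in> poly_fun"
      unfolding poly_altdef by (intro poly_fun_sum poly_fun_scale poly_fun_power pf_coord)
    ultimately have "(\<lambda>x. poly P (x $ i)) \<in> R"
      using poly_prime_mult[OF R(1), of "\<lambda>x. f x ^ k" "\<lambda>x. poly P (x $ i)"]
        poly_fun_power[OF f(1)] by simp
    moreover obtain c where c: "c \<in> C" "b c \<noteq> 0" using C(3) by blast
    \<comment> \<open>At \<open>c\<close> every other summand contains the factor
      \<open>c - c\<close>, so only the summand with \<open>b c\<close> nonzero survives and
      \<open>P\<close> is not zero.\<close>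
    have "poly P c = b c * (\<Prod>d\<in>C - {c}. c - d)"
    proof -
      have "(\<Sum>e\<in>C - {c}. b e * (\<Prod>d\<in>C - {e}. c - d)) = 0"
      proof (rule sum.neutral, rule ballI)
        fix e assume "e \<in> C - {c}"
        then have "(\<Prod>d\<in>C - {e}. c - d) = 0" using C(1) c by (intro prod_zero) auto
        then show "b e * (\<Prod>d\<in>C - {e}. c - d) = 0" by simp
      qed
      then show ?thesis unfolding poly_P by (simp add: sum.remove[OF C(1) c(1)])
    qed
    then have "P \<noteq> 0" using c C(1) by auto
    ultimately show False using prime_contains_linear_factor[OF R(1)] none by blast
  qed
  then obtain c where c: "\<And>i. (\<lambda>x. x $ i - c i) \<in> R" by metis
  define y where "y = (\<chi> i. c i)"
  \<comment> \<open>Modulo \<open>R\<close> every coordinate, hence every polynomial function, is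
    congruent to its value at \<open>y\<close>.\<close>
  have at_y: "(\<lambda>x. p x - p y) \<in> R" if "p \<in> poly_fun" for p
    using that
  proof induction
    case (pf_const c)
    show ?case using poly_ideal_zero[OF idR] by simp
  next
    case (pf_coord i)
    show ?case using c[of i] by (simp add: y_def)
  next
    case (pf_add p q)
    from poly_ideal_add[OF idR pf_add.IH] show ?case by (simp add: algebra_simps)
  next
    case (pf_mult p q)
    have "(\<lambda>x. p x * (q x - q y) + q y * (p x - p y)) \<in> R"
      by (intro poly_ideal_add[OF idR] poly_ideal_mult[OF idR] poly_ideal_scale[OF idR] pf_mult)
    then show ?case by (simp add: algebra_simps)
  qed
  have vanish: "p y = 0" if "p \<in> R" for p
  proof -
    have "p \<in> poly_fun" using that poly_ideal_subset[OF idR] by blast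
    from poly_ideal_diff[OF idR that at_y[OF this]] have "(\<lambda>x. p y) \<in> R" by simp
    then show ?thesis by (rule poly_prime_const[OF R(1)])
  qed
  have "y \<in> zeros Q" using R(2) vanish by (auto simp: zeros_def)
  moreover have "f y \<noteq> 0"
  proof
    assume "f y = 0"
    then have "f \<in> R" using at_y[OF f(1)] by simp
    then show False using R(3) M(3) by blast
  qed
  ultimately show ?thesis using that by blast
qed

section \<open>Irreducibility of the zero sets of prime ideals\<close>

lemma zariski_closed_zeros: "P \<subseteq> poly_fun \<Longrightarrow> zariski_closed (zeros P)"
  by (auto simp: zariski_closed_def zeros_def)

text \<open>If neither closed set contains \<open>zeros Q\<close>, each has an equation outside
  \<open>Q\<close>. The product of the two is outside \<open>Q\<close> by primality, so by the
  Nullstellensatz it is nonzero at a point of \<open>zeros Q\<close>, which then lies in neither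
  set.\<close>

lemma zariski_irreducible_zeros:
  assumes Q: "poly_prime Q"
  shows "zariski_irreducible (zeros Q)"
  unfolding zariski_irreducible_def
proof (intro conjI allI impI)
  show "zeros Q \<noteq> {}"
    using prime_nullstellensatz[OF Q pf_const poly_prime_one[OF Q]] by blast
  show "zariski_closed (zeros Q)"
    by (intro zariski_closed_zeros poly_ideal_subset poly_prime_ideal Q)
next
  fix A B :: "'a pt set" assume AB: "zariski_closed A" "zariski_closed B" "zeros Q \<subseteq> A \<union> B"
  show "zeros Q \<subseteq> A \<or> zeros Q \<subseteq> B"
  proof (rule ccontr)
    assume "\<not> ?thesis"
    then obtain y z where "y \<in> zeros Q" "y \<notin> A" "z \<in> zeros Q" "z \<notin> B" by blast
    moreover obtain P R where PR: "P \<subseteq> poly_fun" "R \<subseteq> poly_fun"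
      "A = {x. \<forall>p\<in>P. p x = 0}" "B = {x. \<forall>p\<in>R. p x = 0}" using AB by (auto simp: zariski_closed_def)
    ultimately obtain p r where pr: "p \<in> P" "r \<in> R" "p \<notin> Q" "r \<notin> Q" by (auto simp: zeros_def)
    then have "p \<in> poly_fun" "r \<in> poly_fun" using PR by auto
    then have "(\<lambda>x. p x * r x) \<in> poly_fun" "(\<lambda>x. p x * r x) \<notin> Q"
      using pf_mult poly_prime_mult[OF Q, of p r] pr by blast+
    then obtain w where "w \<in> zeros Q" "p w * r w \<noteq> 0" by (rule prime_nullstellensatz[OF Q])
    then show False using AB(3) PR pr by auto
  qed
qed

section \<open>Chains of irreducible closed sets from independent coordinates\<close>

text \<open>Phrased by values rather than by monomials, which suits products and evaluation at
  modified points. Meeting \<open>I\<close> only in zero says that the coordinates in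
  \<open>S\<close> are algebraically independent modulo \<open>I\<close>.\<close>

definition depends_only_on :: "'n::finite set \<Rightarrow> 'n fn set" where
  "depends_only_on S = {p \<in> poly_fun. \<forall>x y. (\<forall>i\<in>S. x $ i = y $ i) \<longrightarrow> p x = p y}"

text \<open>The index \<open>k\<close> counts strict inclusions, so there are \<open>k + 1\<close>
  members, as in the definition of \<open>zdim\<close>.\<close>

definition closed_chain :: "'n::finite pt set \<Rightarrow> nat \<Rightarrow> (nat \<Rightarrow> 'n pt set) \<Rightarrow> bool" where
  "closed_chain V k Z \<longleftrightarrow>
     (\<forall>i\<le>k. zariski_irreducible (Z i) \<and> Z i \<subseteq> V) \<and> (\<forall>i<k. Z i \<subset> Z (Suc i))"

text \<open>The nonzero functions of the coordinates in \<open>S\<close> form a multiplicative set,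
  because products of nonzero polynomial functions are nonzero.\<close>

lemma depends_only_on_prime:
  assumes "poly_ideal I" "depends_only_on S \<inter> I \<subseteq> {\<lambda>x. 0}"
  obtains Q where "poly_prime Q" "I \<subseteq> Q" "depends_only_on S \<inter> Q \<subseteq> {\<lambda>x. 0}"
proof -
  let ?M = "depends_only_on S - {\<lambda>x. 0}"
  have M_mult: "(\<lambda>x. p x * q x) \<in> ?M" if pq: "p \<in> ?M" "q \<in> ?M" for p q
  proof -
    have "(\<lambda>x. p x * q x) \<noteq> (\<lambda>x. 0)"
      using pq by (intro poly_fun_domain) (auto simp: depends_only_on_def)
    moreover have "p x * q x = p y * q y" if "\<forall>i\<in>S. x $ i = y $ i" for x y
    proof -
      have "p x = p y" "q x = q y" using pq that unfolding depends_only_on_def by blast+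
      then show ?thesis by simp
    qed
    moreover have "(\<lambda>x. p x * q x) \<in> poly_fun"
      using pq by (intro pf_mult) (auto simp: depends_only_on_def)
    ultimately show ?thesis by (simp add: depends_only_on_def)
  qed
  have M: "?M \<subseteq> poly_fun" "(\<lambda>x. 1) \<in> ?M"
    by (auto simp: depends_only_on_def pf_const fun_eq_iff)
  show ?thesis
  proof (rule prime_avoiding[OF assms(1) M])
    show "(\<lambda>x. p x * q x) \<in> ?M" if "p \<in> ?M" "q \<in> ?M" for p q
      by (rule M_mult[OF that])
    show "I \<inter> ?M = {}" using assms(2) by blast
  next
    fix Q assume "poly_prime Q" "I \<subseteq> Q" "Q \<inter> ?M = {}"
    then show thesis by (intro that) auto
  qed
qed

text \<open>If every \<open>c\<close> failed, there would be a nonzero \<open>r c\<close> in the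
  coordinates \<open>S - {i}\<close> congruent modulo \<open>Q\<close> to a multiple
  \<open>q c\<close> of \<open>x $ i - c\<close>. A linear relation between the \<open>q c\<close>,
  cleared of denominators, gives an element of \<open>Q\<close> in the coordinates of
  \<open>S\<close>, which must be zero yet is nonzero at a suitable point.\<close>

lemma hyperplane_section:
  fixes Q :: "('n::finite) fn set"
  assumes Q: "poly_ideal Q" and S: "i \<in> S" and indep: "depends_only_on S \<inter> Q \<subseteq> {\<lambda>x. 0}"
  shows "\<exists>c. depends_only_on (S - {i}) \<inter> ideal_adjoin Q (\<lambda>x. x $ i - c) \<subseteq> {\<lambda>x. 0}"
proof (rule ccontr)
  assume none: "\<not> ?thesis"
  have "\<forall>c. \<exists>q r. q \<in> poly_fun \<and> r \<in> depends_only_on (S - {i}) \<and> r \<noteq> (\<lambda>x. 0) \<and>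
      (\<lambda>x. r x - q x * (x $ i - c)) \<in> Q"
  proof
    fix c
    obtain r where r: "r \<in> depends_only_on (S - {i})" "r \<noteq> (\<lambda>x. 0)"
      "r \<in> ideal_adjoin Q (\<lambda>x. x $ i - c)"
      using none by blast
    obtain p q where *: "p \<in> Q" "q \<in> poly_fun" "r = (\<lambda>x. p x + q x * (x $ i - c))"
      using r(3) by (rule ideal_adjoinE)
    have "(\<lambda>x. r x - q x * (x $ i - c)) = p" unfolding *(3) by simp
    then have "q \<in> poly_fun \<and> r \<in> depends_only_on (S - {i}) \<and> r \<noteq> (\<lambda>x. 0) \<and>
      (\<lambda>x. r x - q x * (x $ i - c)) \<in> Q" using r * by simp
    then show "\<exists>q r. q \<in> poly_fun \<and> r \<in> depends_only_on (S - {i}) \<and> r \<noteq> (\<lambda>x. 0) \<and>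
      (\<lambda>x. r x - q x * (x $ i - c)) \<in> Q" by (intro exI)
  qed
  from this[unfolded choice_iff]
  obtain q r where qr: "\<forall>c. q c \<in> poly_fun \<and> r c \<in> depends_only_on (S - {i}) \<and> r c \<noteq> (\<lambda>x. 0) \<and>
      (\<lambda>x. r c x - q c x * (x $ i - c)) \<in> Q"
    by (elim exE)
  have q: "q c \<in> poly_fun" and r: "r c \<in> depends_only_on (S - {i})" "r c \<noteq> (\<lambda>x. 0)"
    and inv: "(\<lambda>x. r c x - q c x * (x $ i - c)) \<in> Q" for c
    using spec[OF qr, of c] by simp_all
  obtain C k b where C: "finite C" "\<And>c. c \<in> C \<Longrightarrow> (\<lambda>_. 0) c = (k::nat)"
    "\<exists>c\<in>C. b c \<noteq> 0" "\<And>x. (\<Sum>c\<in>C. b c * q c x) = 0"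
    by (rule dependent_uncountable_family[of q "\<lambda>_. 0", OF q]) (rule that)
  let ?g = "\<lambda>x. \<Sum>c\<in>C. b c * r c x * (\<Prod>d\<in>C - {c}. x $ i - d)"
  have "?g \<in> Q" by (rule clear_denominators[OF Q C(1) q inv C(4)])
  moreover have "?g \<in> depends_only_on S"
  proof -
    have "?g \<in> poly_fun" using r unfolding depends_only_on_def
      by (intro poly_fun_sum pf_mult pf_const poly_fun_prod poly_fun_diff pf_coord) blast
    moreover have "?g x = ?g y" if "\<forall>i\<in>S. x $ i = y $ i" for x y
    proof -
      have "r c x = r c y" for c using r(1)[of c] that by (auto simp: depends_only_on_def)
      moreover have "x $ i = y $ i" using that S by blast
      ultimately show ?thesis by simp
    qed
    ultimately show ?thesis unfolding depends_only_on_def by blast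
  qed
  ultimately have zero: "?g x = 0" for x using indep by (metis (no_types, lifting) IntI singletonD subsetD)
  obtain c where c: "c \<in> C" "b c \<noteq> 0" using C(3) by blast
  obtain z where z: "r c z \<noteq> 0" using r(2)[of c] by (metis ext)
  \<comment> \<open>Moving the coordinate \<open>i\<close> to \<open>c\<close> leaves
    \<open>r c\<close> unchanged and kills all summands except the one of \<open>c\<close>.\<close>
  define y where "y = (\<chi> j. if j = i then c else z $ j)"
  have "r c y = r c z" using r(1)[of c] unfolding depends_only_on_def y_def by auto
  have "(\<Sum>e\<in>C - {c}. b e * r e y * (\<Prod>d\<in>C - {e}. y $ i - d)) = 0"
  proof (rule sum.neutral, rule ballI)
    fix e assume "e \<in> C - {c}"
    then have "(\<Prod>d\<in>C - {e}. y $ i - d) = 0" using C(1) c by (intro prod_zero) (auto simp: y_def)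
    then show "b e * r e y * (\<Prod>d\<in>C - {e}. y $ i - d) = 0" by simp
  qed
  then have "b c * r c y * (\<Prod>d\<in>C - {c}. y $ i - d) = 0"
    using zero[of y] by (simp add: sum.remove[OF C(1) c(1)])
  then show False using c z \<open>r c y = r c z\<close> C(1) by (auto simp: y_def)
qed

text \<open>A prime \<open>Q\<close> over \<open>I\<close> keeps the independence; a hyperplane
  section of it keeps the independence of one coordinate fewer and carries a chain by induction;
  \<open>zeros Q\<close> is put on top.\<close>

lemma closed_chain_of_independent:
  fixes I :: "('n::finite) fn set"
  assumes "finite S" "poly_ideal I" "depends_only_on S \<inter> I \<subseteq> {\<lambda>x. 0}"
  shows "\<exists>Z. closed_chain (zeros I) (card S) Z"
  using assms
proof (induction S arbitrary: I rule: finite_induct)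
  case empty
  then obtain Q where "poly_prime Q" "I \<subseteq> Q" using depends_only_on_prime by metis
  then have "closed_chain (zeros I) 0 (\<lambda>_. zeros Q)"
    using zariski_irreducible_zeros by (auto simp: closed_chain_def zeros_def)
  then show ?case by auto
next
  case (insert i S)
  obtain Q where Q: "poly_prime Q" "I \<subseteq> Q" "depends_only_on (insert i S) \<inter> Q \<subseteq> {\<lambda>x. 0}"
    using depends_only_on_prime[OF insert.prems] by metis
  note idQ = poly_prime_ideal[OF Q(1)]
  obtain c where c: "depends_only_on S \<inter> ideal_adjoin Q (\<lambda>x. x $ i - c) \<subseteq> {\<lambda>x. 0}"
    using hyperplane_section[OF idQ _ Q(3), of i] insert.hyps by auto
  let ?l = "\<lambda>x. x $ i - c"
  have l: "?l \<in> poly_fun" by (intro poly_fun_diff pf_coord pf_const)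
  obtain Z where Z: "closed_chain (zeros (ideal_adjoin Q ?l)) (card S) Z"
    using insert.IH[OF poly_ideal_adjoin[OF idQ l] c] by blast
  \<comment> \<open>Strictness of the last inclusion: \<open>?l\<close> is a nonzero function of the
    independent coordinates, so it is outside \<open>Q\<close> and nonzero somewhere on
    \<open>zeros Q\<close>.\<close>
  have "?l \<in> depends_only_on (insert i S)" using l by (auto simp: depends_only_on_def)
  moreover have "?l \<noteq> (\<lambda>x. 0)"
  proof
    assume "?l = (\<lambda>x. 0)"
    from fun_cong[OF this, of "\<chi> j. c + 1"] show False by simp
  qed
  ultimately have "?l \<notin> Q" using Q(3) by blast
  then obtain y where y: "y \<in> zeros Q" "y $ i - c \<noteq> 0"
    by (rule prime_nullstellensatz[OF Q(1) l])
  have "y \<notin> zeros (ideal_adjoin Q ?l)"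
  proof
    assume "y \<in> zeros (ideal_adjoin Q ?l)"
    then have "\<forall>p\<in>ideal_adjoin Q ?l. p y = 0" by (simp add: zeros_def)
    from bspec[OF this ideal_adjoin_mem[OF idQ l]] have "y $ i - c = 0" .
    then show False using y(2) by simp
  qed
  moreover note \<open>y \<in> zeros Q\<close>
  moreover have "zeros (ideal_adjoin Q ?l) \<subseteq> zeros Q"
    using ideal_adjoin_subset[OF idQ l] unfolding zeros_def by blast
  moreover have "zeros Q \<subseteq> zeros I" using Q(2) unfolding zeros_def by blast
  ultimately have "closed_chain (zeros I) (Suc (card S)) (Z(Suc (card S) := zeros Q))"
    using Z zariski_irreducible_zeros[OF Q(1)]
    unfolding closed_chain_def by (auto simp: le_Suc_eq less_Suc_eq)
  then show ?case using insert.hyps by auto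
qed


section \<open>Independent coordinates from chains of irreducible closed sets\<close>

lemma irreducible_vanish_mult:
  assumes Z: "zariski_irreducible Z" and pq: "p \<in> poly_fun" "q \<in> poly_fun"
    and zero: "\<And>x. x \<in> Z \<Longrightarrow> p x * q x = 0" and y: "y \<in> Z" "p y \<noteq> 0" and x: "x \<in> Z"
  shows "q x = 0"
proof -
  have "zariski_closed {x. p x = 0}" "zariski_closed {x. q x = 0}"
    using zariski_closed_zeros[of "{p}"] zariski_closed_zeros[of "{q}"] pq by (auto simp: zeros_def)
  moreover have "Z \<subseteq> {x. p x = 0} \<union> {x. q x = 0}" using zero by auto
  ultimately have "Z \<subseteq> {x. p x = 0} \<or> Z \<subseteq> {x. q x = 0}"
    using Z unfolding zariski_irreducible_def by blast
  then show ?thesis using x y by auto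
qed

text \<open>On \<open>Z0\<close> only the term \<open>h 0\<close> survives, so \<open>h 0\<close> is
  zero by the hypothesis on coefficients. The remaining sum is a multiple of \<open>f\<close>, which
  can be cancelled on the irreducible \<open>Z\<close>, and the argument repeats.\<close>

lemma irreducible_power_expansion:
  assumes Z: "zariski_irreducible Z" "Z0 \<subseteq> Z" and f: "f \<in> poly_fun" "y \<in> Z" "f y \<noteq> 0"
    and f0: "\<And>x. x \<in> Z0 \<Longrightarrow> f x = 0" and h: "\<And>e. h e \<in> poly_fun"
    and zero: "\<And>x. x \<in> Z \<Longrightarrow> (\<Sum>e\<le>N. f x ^ e * h e x) = 0"
    and Z0: "\<And>e. e \<le> N \<Longrightarrow> \<forall>x\<in>Z0. h e x = 0 \<Longrightarrow> \<forall>x. h e x = 0"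
    and e: "e \<le> N"
  shows "h e x = 0"
  using h zero Z0 e
proof (induction N arbitrary: h e)
  case 0
  have "h 0 x = 0" if "x \<in> Z0" for x using "0.prems"(2)[of x] that Z(2) by auto
  then have "\<forall>x. h 0 x = 0" using "0.prems"(3)[of 0] by blast
  then show ?case using "0.prems"(4) by simp
next
  case (Suc N)
  have expand: "(\<Sum>e\<le>Suc N. f x ^ e * h e x) = h 0 x + f x * (\<Sum>e\<le>N. f x ^ e * h (Suc e) x)" for x
    by (simp add: sum.atMost_Suc_shift sum_distrib_left mult.assoc del: sum.atMost_Suc)
  have "h 0 x = 0" if "x \<in> Z0" for x
    using Suc.prems(2)[of x] that Z(2) f0[OF that] unfolding expand by auto
  then have h0: "h 0 x = 0" for x using Suc.prems(3)[of 0] by blast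
  have tail: "(\<Sum>e\<le>N. f x ^ e * h (Suc e) x) = 0" if "x \<in> Z" for x
  proof (rule irreducible_vanish_mult[OF Z(1) f(1) _ _ f(2,3) that])
    show "(\<lambda>x. \<Sum>e\<le>N. f x ^ e * h (Suc e) x) \<in> poly_fun"
      by (intro poly_fun_sum pf_mult poly_fun_power f(1) Suc.prems(1))
    show "f x * (\<Sum>e\<le>N. f x ^ e * h (Suc e) x) = 0" if "x \<in> Z" for x
      using Suc.prems(2)[OF that] unfolding expand by (simp add: h0)
  qed
  have "h (Suc e) x = 0" if "e \<le> N" for e
  proof (rule Suc.IH[of "\<lambda>e. h (Suc e)" e])
    show "\<forall>x. h (Suc d) x = 0" if "d \<le> N" "\<forall>x\<in>Z0. h (Suc d) x = 0" for d
      by (rule Suc.prems(3)) (use that in auto)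
  qed (fact Suc.prems(1) tail that)+
  then show ?case using h0 Suc.prems(4) by (cases e) auto
qed

text \<open>Exponent vectors with entries at most \<open>N\<close>, kept as lists so that an
  induction on \<open>k\<close> can split off the head.\<close>

definition words :: "nat \<Rightarrow> nat \<Rightarrow> nat list set" where
  "words k N = {t. set t \<subseteq> {..N} \<and> length t = k}"

lemma finite_words [simp]: "finite (words k N)"
  unfolding words_def by (rule finite_lists_length_eq) simp

lemma card_words: "card (words k N) = Suc N ^ k"
  unfolding words_def by (subst card_lists_length_eq) simp_all

lemma sum_words_Suc: "sum F (words (Suc k) N) = (\<Sum>e\<le>N. \<Sum>t\<in>words k N. F (e # t))"
proof -
  have "words (Suc k) N = (\<lambda>(e, t). e # t) ` ({..N} \<times> words k N)"
    unfolding words_def by (auto simp: length_Suc_conv image_iff)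
  moreover have "inj_on (\<lambda>(e, t). e # t) ({..N} \<times> words k N)" by (auto simp: inj_on_def)
  ultimately have "sum F (words (Suc k) N) = (\<Sum>(e, t)\<in>{..N} \<times> words k N. F (e # t))"
    by (simp add: sum.reindex case_prod_unfold)
  then show ?thesis by (simp add: sum.cartesian_product)
qed

text \<open>Picking \<open>f\<^sub>j\<close> that vanishes on \<open>Z j\<close> but not on \<open>Z (Suc j)\<close> gives algebraically
  independent functions on \<open>Z k\<close>; the \<open>g t\<close> are their monomials of exponents at most \<open>N\<close>.\<close>

lemma chain_independent_family:
  fixes Z :: "nat \<Rightarrow> ('n::finite) pt set"
  assumes "closed_chain V k Z"
  shows "\<exists>M\<ge>1. \<forall>N. \<exists>g. (\<forall>t\<in>words k N. g t \<in> poly_level (M ^ N)) \<and>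
    (\<forall>u. (\<forall>x\<in>Z k. (\<Sum>t\<in>words k N. u t * g t x) = 0) \<longrightarrow> (\<forall>t\<in>words k N. u t = 0))"
  using assms
proof (induction k)
  case 0
  then obtain y where "y \<in> Z 0" by (auto simp: closed_chain_def zariski_irreducible_def)
  have "words 0 N = {[]}" for N by (auto simp: words_def)
  then show ?case using \<open>y \<in> Z 0\<close> poly_level_one
    by (intro exI[of _ 1] conjI allI exI[of _ "\<lambda>t x. 1"]) auto
next
  case (Suc k)
  then have "closed_chain V k Z" by (auto simp: closed_chain_def)
  from Suc.IH[OF this] obtain M where M: "M \<ge> 1" and
    ex: "\<And>N. \<exists>g. (\<forall>t\<in>words k N. g t \<in> poly_level (M ^ N)) \<and>
    (\<forall>u. (\<forall>x\<in>Z k. (\<Sum>t\<in>words k N. u t * g t x) = 0) \<longrightarrow> (\<forall>t\<in>words k N. u t = 0))"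
    by (elim exE conjE) (rule that; blast)
  have irr: "zariski_irreducible (Z (Suc k))" and "zariski_irreducible (Z k)" and "Z k \<subset> Z (Suc k)"
    using Suc.prems by (auto simp: closed_chain_def)
  obtain y where y: "y \<in> Z (Suc k)" "y \<notin> Z k" using \<open>Z k \<subset> Z (Suc k)\<close> by blast
  obtain P where P: "P \<subseteq> poly_fun" "Z k = {x. \<forall>p\<in>P. p x = 0}"
    using \<open>zariski_irreducible (Z k)\<close> unfolding zariski_irreducible_def zariski_closed_def by blast
  then obtain f where f: "f \<in> poly_fun" "f y \<noteq> 0" and f0: "\<And>x. x \<in> Z k \<Longrightarrow> f x = 0"
    using y(2) by blast
  obtain L where "f \<in> poly_level L" using poly_fun_poly_level[OF f(1)] by blast
  \<comment> \<open>\<open>Suc L\<close> makes the base positive, so that its powers are monotone in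
    the exponent.\<close>
  then have L: "f \<in> poly_level (Suc L)" using poly_level_mono[of L "Suc L"] by auto
  have "\<exists>g. (\<forall>t\<in>words (Suc k) N. g t \<in> poly_level ((Suc L * M) ^ N)) \<and>
    (\<forall>u. (\<forall>x\<in>Z (Suc k). (\<Sum>t\<in>words (Suc k) N. u t * g t x) = 0) \<longrightarrow> (\<forall>t\<in>words (Suc k) N. u t = 0))" for N
  proof -
    obtain g where g: "\<And>t. t \<in> words k N \<Longrightarrow> g t \<in> poly_level (M ^ N)"
      and indep: "\<And>u. \<forall>x\<in>Z k. (\<Sum>t\<in>words k N. u t * g t x) = 0 \<Longrightarrow> \<forall>t\<in>words k N. u t = 0"
      using ex[of N] by auto
    \<comment> \<open>The head of a word is the exponent of the new function \<open>f\<close>, the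
      tail names a monomial in the earlier ones.\<close>
    define g' where "g' s = (\<lambda>x. f x ^ hd s * g (tl s) x)" for s
    have "g' s \<in> poly_level ((Suc L * M) ^ N)" if s_in: "s \<in> words (Suc k) N" for s
    proof -
      obtain e t where s: "s = e # t" "e \<le> N" "t \<in> words k N"
        using s_in by (auto simp: words_def length_Suc_conv)
      have "g' s \<in> poly_level (Suc L ^ e * M ^ N)"
        unfolding g'_def s(1) using s by (auto intro!: poly_level_mult poly_level_power L g)
      moreover have "Suc L ^ e * M ^ N \<le> (Suc L * M) ^ N"
        unfolding power_mult_distrib using s by (intro mult_right_mono power_increasing) auto
      ultimately show ?thesis using poly_level_mono by blast
    qed
    moreover have "\<forall>t\<in>words (Suc k) N. u t = 0"
      if zero: "\<forall>x\<in>Z (Suc k). (\<Sum>t\<in>words (Suc k) N. u t * g' t x) = 0" for u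
    proof -
      \<comment> \<open>The coefficient of \<open>f ^ e\<close>: a combination of the earlier
        family, so it is zero everywhere once it vanishes on \<open>Z k\<close>.\<close>
      define h where "h e = (\<lambda>x. \<Sum>t\<in>words k N. u (e # t) * g t x)" for e
      have h: "h e \<in> poly_fun" for e
        unfolding h_def using g poly_level_poly_fun by (intro poly_fun_sum poly_fun_scale) blast
      have h_sum: "(\<Sum>e\<le>N. f x ^ e * h e x) = 0" if "x \<in> Z (Suc k)" for x
      proof -
        have "(\<Sum>e\<le>N. f x ^ e * h e x) = (\<Sum>t\<in>words (Suc k) N. u t * g' t x)"
          unfolding sum_words_Suc by (simp add: g'_def h_def sum_distrib_left mult_ac)
        then show ?thesis using zero that by simp
      qed
      have h_zero: "\<forall>x. h e x = 0" if "\<forall>x\<in>Z k. h e x = 0" for e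
        using indep[of "\<lambda>t. u (e # t)"] that by (simp add: h_def)
      have he: "h e x = 0" if "e \<le> N" for e x
      proof (rule irreducible_power_expansion)
        show "zariski_irreducible (Z (Suc k))" "Z k \<subseteq> Z (Suc k)" "f \<in> poly_fun" "y \<in> Z (Suc k)" "f y \<noteq> 0"
          using irr \<open>Z k \<subset> Z (Suc k)\<close> f y by auto
        show "e \<le> N" by (rule that)
      qed (fact f0 h h_sum | erule h_zero)+
      show ?thesis
      proof
        fix s assume "s \<in> words (Suc k) N"
        then obtain e t where s: "s = e # t" "e \<le> N" "t \<in> words k N"
          by (auto simp: words_def length_Suc_conv)
        have "\<forall>t\<in>words k N. u (e # t) = 0"
          using indep[of "\<lambda>t. u (e # t)"] he[OF s(2)] by (simp add: h_def)
        then show "u s = 0" using s by simp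
      qed
    qed
    ultimately show ?thesis by blast
  qed
  moreover have "Suc L * M \<ge> 1" using M by simp
  ultimately show ?case by blast
qed

section \<open>Standard monomials and their number\<close>

text \<open>For an ideal \<open>I\<close>, the exponents that are not leading exponents of elements
  of \<open>I\<close>. Weights are positive integers, so the bound \<open>weight a - 1\<close> means
  strictly smaller weight.\<close>

definition standard_monomial :: "('n::finite) fn set \<Rightarrow> ('n \<Rightarrow> nat) \<Rightarrow> bool" where
  "standard_monomial I a \<longleftrightarrow> (\<forall>q\<in>poly_level (weight a - 1). (\<lambda>x. monomial_fun a x - q x) \<notin> I)"

text \<open>Multiplying a reduction of the monomial \<open>b\<close> by the monomial of exponent
  \<open>a - b\<close> would reduce the monomial \<open>a\<close>.\<close>

lemma standard_monomial_mono:
  assumes I: "poly_ideal I" and a: "standard_monomial I a" and le: "\<And>i. b i \<le> a i"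
  shows "standard_monomial I b"
  unfolding standard_monomial_def
proof (intro ballI notI)
  fix q assume q: "q \<in> poly_level (weight b - 1)" "(\<lambda>x. monomial_fun b x - q x) \<in> I"
  define c where "c i = a i - b i" for i
  have ac: "a = (\<lambda>i. b i + c i)" using le by (auto simp: c_def)
  have "(\<lambda>x. monomial_fun c x * (monomial_fun b x - q x)) \<in> I"
    by (rule poly_ideal_mult[OF I monomial_fun_poly_fun q(2)])
  then have "(\<lambda>x. monomial_fun a x - q x * monomial_fun c x) \<in> I"
    unfolding ac monomial_fun_add by (simp add: algebra_simps)
  moreover have qc: "(\<lambda>x. q x * monomial_fun c x) \<in> poly_level (weight a - 1)"
  proof -
    have "(\<lambda>x. q x * monomial_fun c x) \<in> poly_level ((weight b - 1) * weight c)"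
      by (intro poly_level_mult q(1) poly_level_monomial) (simp add: level_def)
    \<comment> \<open>The product is \<open>weight a - weight c\<close>, and \<open>weight c\<close>
      is at least 1.\<close>
    moreover have "(weight b - 1) * weight c \<le> weight a - 1"
      unfolding ac weight_add diff_mult_distrib by (simp add: diff_le_mono2 Suc_le_eq)
    ultimately show ?thesis using poly_level_mono by blast
  qed
  ultimately show False using bspec[OF a[unfolded standard_monomial_def] qc] by simp
qed

definition reducible_level :: "('n::finite) fn set \<Rightarrow> nat \<Rightarrow> 'n fn set" where
  "reducible_level I N = {p. \<exists>v. (\<lambda>x. p x - (\<Sum>a\<in>Collect (standard_monomial I) \<inter> level N.
      v a * monomial_fun a x)) \<in> I}"

lemma reducible_levelI:
  "(\<lambda>x. p x - (\<Sum>a\<in>Collect (standard_monomial I) \<inter> level N. v a * monomial_fun a x)) \<in> I \<Longrightarrow>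
    p \<in> reducible_level I N"
  unfolding reducible_level_def by blast

lemma reducible_level_add:
  assumes I: "poly_ideal I" and p: "p \<in> reducible_level I N" and q: "q \<in> reducible_level I N"
  shows "(\<lambda>x. p x + q x) \<in> reducible_level I N"
proof -
  let ?T = "Collect (standard_monomial I) \<inter> level N"
  obtain v where v: "(\<lambda>x. p x - (\<Sum>a\<in>?T. v a * monomial_fun a x)) \<in> I"
    using p by (auto simp: reducible_level_def)
  obtain w where w: "(\<lambda>x. q x - (\<Sum>a\<in>?T. w a * monomial_fun a x)) \<in> I"
    using q by (auto simp: reducible_level_def)
  have "(\<lambda>x. p x + q x - (\<Sum>a\<in>?T. (v a + w a) * monomial_fun a x)) \<in> I"
    using poly_ideal_add[OF I v w] by (simp add: algebra_simps sum.distrib)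
  then show ?thesis by (rule reducible_levelI[where v = "\<lambda>a. v a + w a"])
qed

lemma reducible_level_scale:
  assumes I: "poly_ideal I" and p: "p \<in> reducible_level I N"
  shows "(\<lambda>x. c * p x) \<in> reducible_level I N"
proof -
  let ?T = "Collect (standard_monomial I) \<inter> level N"
  obtain v where v: "(\<lambda>x. p x - (\<Sum>a\<in>?T. v a * monomial_fun a x)) \<in> I"
    using p by (auto simp: reducible_level_def)
  have "(\<lambda>x. c * p x - (\<Sum>a\<in>?T. (c * v a) * monomial_fun a x)) \<in> I"
    using poly_ideal_scale[OF I v, of c] by (simp add: right_diff_distrib sum_distrib_left mult.assoc)
  then show ?thesis by (rule reducible_levelI[where v = "\<lambda>a. c * v a"])
qed

lemma reducible_level_ideal: "p \<in> I \<Longrightarrow> p \<in> reducible_level I N"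
  by (rule reducible_levelI[where v = "\<lambda>_. 0"]) simp

lemma reducible_level_sum:
  "poly_ideal I \<Longrightarrow> (\<And>t. t \<in> T \<Longrightarrow> p t \<in> reducible_level I N) \<Longrightarrow>
    (\<lambda>x. \<Sum>t\<in>T. p t x) \<in> reducible_level I N"
proof (induction T rule: infinite_finite_induct)
  case (insert t T)
  then show ?case using reducible_level_add[of I "p t" N "\<lambda>x. \<Sum>t\<in>T. p t x"] by auto
qed (auto intro: poly_ideal_zero reducible_level_ideal)

text \<open>By induction on the weight: a non-standard monomial is congruent to a combination of
  lighter monomials, to which the induction hypothesis applies.\<close>

lemma reducible_level_monomial:
  fixes I :: "('n::finite) fn set"
  assumes I: "poly_ideal I" and "a \<in> level N"
  shows "monomial_fun a \<in> reducible_level I N"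
  using assms(2)
proof (induction "weight a" arbitrary: a rule: less_induct)
  case less
  show ?case
  proof (cases "standard_monomial I a")
    case True
    let ?T = "Collect (standard_monomial I) \<inter> level N"
    have "(\<Sum>b\<in>?T. of_bool (b = a) * monomial_fun b x) = monomial_fun a x" for x
    proof -
      have "(\<Sum>b\<in>?T. of_bool (b = a) * monomial_fun b x)
          = (\<Sum>b\<in>?T. if b = a then monomial_fun b x else 0)"
        by (rule sum.cong) auto
      then show ?thesis using True less.prems by simp
    qed
    then have "(\<lambda>x. monomial_fun a x - (\<Sum>b\<in>?T. of_bool (b = a) * monomial_fun b x)) \<in> I"
      using poly_ideal_zero[OF I] by simp
    then show ?thesis by (rule reducible_levelI[where v = "\<lambda>b. of_bool (b = a)"])
  next
    case False
    then obtain q where q: "q \<in> poly_level (weight a - 1)" "(\<lambda>x. monomial_fun a x - q x) \<in> I"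
      by (auto simp: standard_monomial_def)
    obtain u where u: "q = (\<lambda>x. \<Sum>b\<in>level (weight a - 1). u b * monomial_fun b x)"
      using q(1) by (auto simp: poly_level_def)
    have "monomial_fun b \<in> reducible_level I N" if "b \<in> level (weight a - 1)" for b
    proof (rule less.hyps)
      have "weight b \<le> weight a - 1" using that by (simp add: level_def)
      then show "weight b < weight a" using weight_pos[of a] by linarith
      then show "b \<in> level N" using less.prems by (simp add: level_def)
    qed
    then have "q \<in> reducible_level I N"
      unfolding u by (intro reducible_level_sum[OF I] reducible_level_scale[OF I])
    from reducible_level_add[OF I reducible_level_ideal[OF q(2)] this] show ?thesis by simp
  qed
qed

lemma poly_level_reducible: "poly_ideal I \<Longrightarrow> poly_level N \<subseteq> reducible_level I N"
  by (auto simp: poly_level_def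
      intro!: reducible_level_sum reducible_level_scale reducible_level_monomial)

section \<open>Algebraically independent coordinates\<close>

definition level_on :: "('n::finite) set \<Rightarrow> nat \<Rightarrow> ('n \<Rightarrow> nat) set" where
  "level_on S N = {a \<in> level N. \<forall>i. i \<notin> S \<longrightarrow> a i = 0}"

lemma finite_level_on [simp]: "finite (level_on S N)"
  by (simp add: level_on_def)

text \<open>Algebraic independence of the coordinates in \<open>S\<close> modulo \<open>I\<close>,
  cut into one finite linear condition for each \<open>N\<close>; each of these will become an open
  condition on the point that determines \<open>I\<close>.\<close>

definition independent_coords :: "('n::finite) fn set \<Rightarrow> 'n set \<Rightarrow> bool" where
  "independent_coords I S \<longleftrightarrow> (\<forall>N u. (\<lambda>x. \<Sum>a\<in>level_on S N. u a * monomial_fun a x) \<in> I \<longrightarrow>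
      (\<forall>a\<in>level_on S N. u a = 0))"

text \<open>In a nontrivial relation the heaviest monomial with nonzero coefficient is unique, as
  weights determine exponents, and the relation rewrites it by lighter ones. So it would not be
  standard.\<close>

lemma independent_coordsI_standard:
  assumes I: "poly_ideal I" and std: "\<And>a. (\<And>i. i \<notin> S \<Longrightarrow> a i = 0) \<Longrightarrow> standard_monomial I a"
  shows "independent_coords I S"
  unfolding independent_coords_def
proof (intro allI impI, rule ccontr)
  fix N u
  assume mem: "(\<lambda>x. \<Sum>a\<in>level_on S N. u a * monomial_fun a x) \<in> I"
    and "\<not> (\<forall>a\<in>level_on S N. u a = 0)"
  let ?A = "{a \<in> level_on S N. u a \<noteq> 0}"
  have ne: "?A \<noteq> {}" using \<open>\<not> (\<forall>a\<in>level_on S N. u a = 0)\<close> by auto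
  then have "Max (weight ` ?A) \<in> weight ` ?A" by (intro Max_in) auto
  then obtain a where "weight a = Max (weight ` ?A)" and a: "a \<in> level_on S N" "u a \<noteq> 0" by auto
  then have max: "weight b \<le> weight a" if "b \<in> level_on S N" "u b \<noteq> 0" for b
    using that by simp
  define q where "q = (\<lambda>x. \<Sum>b\<in>level_on S N - {a}. (- (u b / u a)) * monomial_fun b x)"
  have q: "q \<in> poly_level (weight a - 1)"
    unfolding q_def
  proof (rule poly_level_sum)
    fix b assume b: "b \<in> level_on S N - {a}"
    show "(\<lambda>x. (- (u b / u a)) * monomial_fun b x) \<in> poly_level (weight a - 1)"
    proof (cases "u b = 0")
      case True
      then show ?thesis using poly_level_zero by simp
    next
      case False
      then have "weight b \<le> weight a" using max b by simp
      moreover have "weight b \<noteq> weight a" using inj_weight b by (auto dest: injD)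
      ultimately show ?thesis by (intro poly_level_scale poly_level_monomial) (simp add: level_def)
    qed
  qed
  have "(\<lambda>x. monomial_fun a x - q x) \<in> I"
  proof -
    have "monomial_fun a x - q x = (1 / u a) * (\<Sum>b\<in>level_on S N. u b * monomial_fun b x)" for x
      using a by (simp add: q_def sum.remove[OF _ a(1)] distrib_left sum_distrib_left sum_negf)
    then show ?thesis using poly_ideal_scale[OF I mem, of "1 / u a"] by simp
  qed
  moreover have "standard_monomial I a" using a by (intro std) (auto simp: level_on_def)
  then have "(\<lambda>x. monomial_fun a x - q x) \<notin> I"
    unfolding standard_monomial_def using q by (rule bspec)
  ultimately show False by simp
qed

lemma card_bounded_exponents:
  fixes T :: "('n::finite) set"
  assumes "B \<ge> 1" "card T \<le> k"
  shows "card {a :: 'n \<Rightarrow> nat. \<forall>i. a i \<le> D \<and> (i \<notin> T \<longrightarrow> a i < B)} \<le> B ^ CARD('n) * Suc D ^ k"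
    and "finite {a :: 'n \<Rightarrow> nat. \<forall>i. a i \<le> D \<and> (i \<notin> T \<longrightarrow> a i < B)}"
proof -
  let ?F = "\<lambda>i. if i \<in> T then {..D} else {..<B}"
  let ?P = "PiE UNIV ?F"
  have sub: "{a :: 'n \<Rightarrow> nat. \<forall>i. a i \<le> D \<and> (i \<notin> T \<longrightarrow> a i < B)} \<subseteq> ?P"
    by (auto simp: PiE_def Pi_def)
  have fin: "finite ?P" by (rule finite_PiE) auto
  show "finite {a :: 'n \<Rightarrow> nat. \<forall>i. a i \<le> D \<and> (i \<notin> T \<longrightarrow> a i < B)}"
    using finite_subset[OF sub fin] .
  have "card ?P = (\<Prod>i\<in>UNIV. card (?F i))" by (rule card_PiE) simp
  \<comment> \<open>Allowing the factor \<open>B\<close> at every coordinate, also those in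
    \<open>T\<close>, gives a bound that depends on \<open>T\<close> only through its size.\<close>
  also have "\<dots> \<le> (\<Prod>i\<in>UNIV. B * (if i \<in> T then Suc D else 1))"
    using assms(1) mult_le_mono1[OF assms(1), of "Suc D"] by (intro prod_mono) auto
  also have "\<dots> = B ^ CARD('n) * Suc D ^ card T"
    by (simp add: prod.distrib prod.If_cases)
  also have "\<dots> \<le> B ^ CARD('n) * Suc D ^ k"
    using assms(2) by (intro mult_left_mono power_increasing) auto
  finally show "card {a :: 'n \<Rightarrow> nat. \<forall>i. a i \<le> D \<and> (i \<notin> T \<longrightarrow> a i < B)} \<le> B ^ CARD('n) * Suc D ^ k"
    using card_mono[OF fin sub] by simp
qed

text \<open>Fewer than \<open>k\<close> exponents of a standard monomial can be large, so the number
  of those of weight at most \<open>M ^ N\<close> is bounded by a constant times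
  \<open>(M * Suc N) ^ (k - 1)\<close>. Multiplying by \<open>Suc N\<close> instead of writing
  \<open>k - 1\<close> also covers \<open>k = 0\<close>. The constant \<open>C\<close> does not
  depend on \<open>M\<close> or \<open>N\<close>.\<close>

lemma card_standard_monomials:
  fixes I :: "('n::finite) fn set"
  assumes I: "poly_ideal I"
    and nonstd: "\<And>S. card S = k \<Longrightarrow> \<exists>a. (\<forall>i. i \<notin> S \<longrightarrow> a i = 0) \<and> \<not> standard_monomial I a"
  shows "\<exists>C. \<forall>M\<ge>1. \<forall>N. card (Collect (standard_monomial I) \<inter> level (M ^ N)) * Suc N \<le> C * (M * Suc N) ^ k"
proof -
  obtain m where m: "\<And>S i. card S = k \<Longrightarrow> i \<notin> S \<Longrightarrow> m S i = 0"
    "\<And>S. card S = k \<Longrightarrow> \<not> standard_monomial I (m S)"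
    using nonstd by metis
  \<comment> \<open>Exceeds every exponent of the chosen non-standard monomials
    \<open>m S\<close>.\<close>
  define B where "B = Suc (\<Sum>S\<in>UNIV. \<Sum>i\<in>UNIV. m S i)"
  have B: "m S i < B" for S i
  proof -
    have "m S i \<le> (\<Sum>i\<in>UNIV. m S i)" by (rule member_le_sum) auto
    also have "\<dots> \<le> (\<Sum>S\<in>UNIV. \<Sum>i\<in>UNIV. m S i)" by (rule member_le_sum) auto
    finally show ?thesis by (simp add: B_def)
  qed
  \<comment> \<open>If \<open>k\<close> exponents reached \<open>B\<close>, the non-standard
    \<open>m S\<close> on those coordinates would divide the monomial, which is impossible for a
    standard one.\<close>
  have few: "card {i. B \<le> a i} < k" if a: "standard_monomial I a" for a
  proof (rule ccontr)
    assume "\<not> ?thesis"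
    then obtain S where S: "S \<subseteq> {i. B \<le> a i}" "card S = k"
      by (meson not_less obtain_subset_with_card_n)
    have "m S i \<le> a i" for i
      using B[of S i] S m(1)[OF S(2), of i] by (cases "i \<in> S") auto
    then show False using standard_monomial_mono[OF I a] m(2)[OF S(2)] by blast
  qed
  let ?C = "card (UNIV :: 'n set set) * B ^ CARD('n)"
  have "card (Collect (standard_monomial I) \<inter> level (M ^ N)) * Suc N \<le> ?C * (M * Suc N) ^ k"
    if M: "M \<ge> 1" for M N
  proof (cases k)
    case 0
    have none: "Collect (standard_monomial I) = {}" using few 0 by fastforce
    show ?thesis unfolding none by simp
  next
    case (Suc l)
    let ?E = "\<lambda>T. {a :: 'n \<Rightarrow> nat. \<forall>i. a i \<le> M * N \<and> (i \<notin> T \<longrightarrow> a i < B)}"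
    have "Collect (standard_monomial I) \<inter> level (M ^ N) \<subseteq> (\<Union>T\<in>{T. card T \<le> l}. ?E T)"
    proof
      fix a assume a: "a \<in> Collect (standard_monomial I) \<inter> level (M ^ N)"
      have "a i \<le> M * N" for i
      proof -
        have "2 ^ a i \<le> M ^ N" using two_power_le_weight[of a i] a by (auto simp: level_def)
        \<comment> \<open>From \<open>M\<close> \<le> \<open>2 ^ M\<close>, exponents are bounded
          linearly in \<open>N\<close> although the weight bound is exponential.\<close>
        also have "\<dots> \<le> (2 ^ M) ^ N" by (intro power_mono) (auto intro: less_imp_le less_exp)
        finally show ?thesis by (simp add: power_mult[symmetric])
      qed
      moreover have "card {i. B \<le> a i} \<le> l" using few[of a] a Suc by auto
      ultimately show "a \<in> (\<Union>T\<in>{T. card T \<le> l}. ?E T)"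
        by (intro UN_I[of "{i. B \<le> a i}"]) auto
    qed
    moreover have fin: "finite (?E T)" if "T \<in> {T. card T \<le> l}" for T
      using card_bounded_exponents(2)[of B T l "M * N"] that by (auto simp: B_def)
    ultimately have "card (Collect (standard_monomial I) \<inter> level (M ^ N))
        \<le> card (\<Union>T\<in>{T. card T \<le> l}. ?E T)"
      by (intro card_mono finite_UN_I) auto
    also have "\<dots> \<le> (\<Sum>T\<in>{T. card T \<le> l}. card (?E T))" by (rule card_UN_le) simp
    also have "\<dots> \<le> (\<Sum>T\<in>{T :: 'n set. card T \<le> l}. B ^ CARD('n) * Suc (M * N) ^ l)"
      by (intro sum_mono card_bounded_exponents(1)) (auto simp: B_def)
    also have "\<dots> = card {T :: 'n set. card T \<le> l} * (B ^ CARD('n) * Suc (M * N) ^ l)" by simp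
    also have "\<dots> \<le> card (UNIV :: 'n set set) * (B ^ CARD('n) * (M * Suc N) ^ l)"
      using M by (intro mult_mono power_mono card_mono) auto
    finally have "card (Collect (standard_monomial I) \<inter> level (M ^ N)) * Suc N
        \<le> card (UNIV :: 'n set set) * (B ^ CARD('n) * (M * Suc N) ^ l) * (M * Suc N)"
      using M mult_le_mono1[OF M, of "Suc N"] by (intro mult_mono) auto
    then show ?thesis by (simp only: Suc power_Suc mult_ac)
  qed
  then show ?thesis by blast
qed

text \<open>A dimension count: the chain gives \<open>Suc N ^ k\<close> functions, linearly
  independent on \<open>Z k\<close>, that reduce modulo \<open>I\<close> to standard monomials of
  level \<open>M ^ N\<close>. If no \<open>S\<close> of size \<open>k\<close> were independent,
  there would be too few of those monomials for a suitable \<open>N\<close>.\<close>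

lemma independent_coords_of_chain:
  fixes I :: "('n::finite) fn set"
  assumes I: "poly_ideal I" and chain: "closed_chain (zeros I) k Z"
  shows "\<exists>S. card S = k \<and> independent_coords I S"
proof (rule ccontr)
  assume none: "\<not> ?thesis"
  have "\<exists>a. (\<forall>i. i \<notin> S \<longrightarrow> a i = 0) \<and> \<not> standard_monomial I a" if "card S = k" for S
    using none that independent_coordsI_standard[OF I, of S] by blast
  from card_standard_monomials[OF I this] obtain C where
    C: "\<And>M N. M \<ge> 1 \<Longrightarrow> card (Collect (standard_monomial I) \<inter> level (M ^ N)) * Suc N \<le> C * (M * Suc N) ^ k"
    by blast
  obtain M where M: "M \<ge> 1" and
    fam: "\<And>N. \<exists>g. (\<forall>t\<in>words k N. g t \<in> poly_level (M ^ N)) \<and>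
    (\<forall>u. (\<forall>x\<in>Z k. (\<Sum>t\<in>words k N. u t * g t x) = 0) \<longrightarrow> (\<forall>t\<in>words k N. u t = 0))"
    using chain_independent_family[OF chain] by (elim exE conjE) (rule that; blast)
  \<comment> \<open>With this \<open>N\<close>, the bound \<open>C * (M * Suc N) ^ k\<close> equals
    \<open>Suc N ^ k * N\<close>, which is less than \<open>Suc N ^ k * Suc N\<close>.\<close>
  define N where "N = C * M ^ k"
  let ?T = "Collect (standard_monomial I) \<inter> level (M ^ N)"
  obtain g where g: "\<And>t. t \<in> words k N \<Longrightarrow> g t \<in> poly_level (M ^ N)"
    and indep: "\<And>u. \<forall>x\<in>Z k. (\<Sum>t\<in>words k N. u t * g t x) = 0 \<Longrightarrow> \<forall>t\<in>words k N. u t = 0"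
    using fam[of N] by auto
  have "\<forall>t\<in>words k N. \<exists>v. (\<lambda>x. g t x - (\<Sum>a\<in>?T. v a * monomial_fun a x)) \<in> I"
    using g poly_level_reducible[OF I] by (auto simp: reducible_level_def)
  from this[unfolded bchoice_iff] obtain v where
    v_all: "\<forall>t\<in>words k N. (\<lambda>x. g t x - (\<Sum>a\<in>?T. v t a * monomial_fun a x)) \<in> I"
    by (elim exE)
  have v: "(\<lambda>x. g t x - (\<Sum>a\<in>?T. v t a * monomial_fun a x)) \<in> I" if "t \<in> words k N" for t
    using bspec[OF v_all that] .
  have "card ?T < card (words k N)"
  proof (rule ccontr)
    assume "\<not> ?thesis"
    then have "Suc N ^ k * Suc N \<le> card ?T * Suc N"
      unfolding card_words by (intro mult_le_mono1) simp
    also have "\<dots> \<le> C * (M * Suc N) ^ k" by (rule C[OF M])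
    also have "\<dots> = Suc N ^ k * N" by (simp only: N_def power_mult_distrib mult_ac)
    finally show False by simp
  qed
  then obtain u where u: "\<exists>t\<in>words k N. u t \<noteq> 0"
    "\<And>a. a \<in> ?T \<Longrightarrow> (\<Sum>t\<in>words k N. u t * v t a) = 0"
    using underdetermined_system[of ?T "words k N" v] by auto
  \<comment> \<open>The coefficients \<open>u\<close> cancel all standard parts, so the combination
    of the \<open>g t\<close> is itself in \<open>I\<close> and vanishes on
    \<open>Z k\<close>.\<close>
  have "(\<Sum>t\<in>words k N. u t * (g t x - (\<Sum>a\<in>?T. v t a * monomial_fun a x)))
      = (\<Sum>t\<in>words k N. u t * g t x)" for x
  proof -
    have "(\<Sum>t\<in>words k N. u t * (\<Sum>a\<in>?T. v t a * monomial_fun a x))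
        = (\<Sum>a\<in>?T. (\<Sum>t\<in>words k N. u t * v t a) * monomial_fun a x)"
      unfolding sum_distrib_left sum_distrib_right by (subst sum.swap) (simp add: mult.assoc)
    then show ?thesis using u(2) by (simp add: right_diff_distrib sum_subtractf)
  qed
  then have mem: "(\<lambda>x. \<Sum>t\<in>words k N. u t * g t x) \<in> I"
    using poly_ideal_sum[OF I, of "words k N" "\<lambda>t x. u t * (g t x - (\<Sum>a\<in>?T. v t a * monomial_fun a x))"]
      poly_ideal_scale[OF I v] by simp
  have "\<forall>x\<in>Z k. (\<Sum>t\<in>words k N. u t * g t x) = 0"
  proof
    fix x assume "x \<in> Z k"
    then have "\<forall>p\<in>I. p x = 0" using chain by (auto simp: closed_chain_def zeros_def)
    from bspec[OF this mem] show "(\<Sum>t\<in>words k N. u t * g t x) = 0" .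
  qed
  from indep[OF this] show False using u(1) by blast
qed

text \<open>A function of the coordinates in \<open>S\<close> does not change when the other
  coordinates are set to zero, which leaves only monomials in \<open>S\<close>. So independence by
  monomials gives independence by values.\<close>

lemma chain_of_independent_coords:
  fixes I :: "('n::finite) fn set"
  assumes I: "poly_ideal I" and S: "independent_coords I S"
  shows "\<exists>Z. closed_chain (zeros I) (card S) Z"
proof (rule closed_chain_of_independent[OF _ I])
  show "depends_only_on S \<inter> I \<subseteq> {\<lambda>x. 0}"
  proof
    fix p assume p: "p \<in> depends_only_on S \<inter> I"
    then obtain N where "p \<in> poly_level N"
      using poly_fun_poly_level[of p] by (auto simp: depends_only_on_def)
    then obtain u where u: "p = (\<lambda>x. \<Sum>a\<in>level N. u a * monomial_fun a x)" by (auto simp: poly_level_def)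
    have eq: "p = (\<lambda>x. \<Sum>a\<in>level_on S N. u a * monomial_fun a x)"
    proof
      fix x :: "'n pt"
      define y where "y = (\<chi> i. if i \<in> S then x $ i else 0)"
      have "p x = p y" using p by (auto simp: depends_only_on_def y_def)
      also have "\<dots> = (\<Sum>a\<in>level N. u a * monomial_fun a y)" by (simp add: u)
      also have "\<dots> = (\<Sum>a\<in>level_on S N. u a * monomial_fun a y)"
      proof (rule sum.mono_neutral_right)
        show "\<forall>a\<in>level N - level_on S N. u a * monomial_fun a y = 0"
        proof
          fix a assume "a \<in> level N - level_on S N"
          then obtain i where "i \<notin> S" "a i \<noteq> 0" by (auto simp: level_on_def)
          then have "monomial_fun a y = 0"
            unfolding monomial_fun_def by (intro prod_zero bexI[of _ i]) (auto simp: y_def)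
          then show "u a * monomial_fun a y = 0" by simp
        qed
      qed (auto simp: level_on_def)
      also have "\<dots> = (\<Sum>a\<in>level_on S N. u a * monomial_fun a x)"
      proof (rule sum.cong)
        fix a assume "a \<in> level_on S N"
        then have "y $ i ^ a i = x $ i ^ a i" for i by (auto simp: level_on_def y_def)
        then show "u a * monomial_fun a y = u a * monomial_fun a x" by (simp add: monomial_fun_def)
      qed simp
      finally show "p x = (\<Sum>a\<in>level_on S N. u a * monomial_fun a x)" .
    qed
    then have "\<forall>a\<in>level_on S N. u a = 0" using S p unfolding independent_coords_def by auto
    then show "p \<in> {\<lambda>x. 0}" using eq by simp
  qed
qed simp

text \<open>Lengths of chains and sizes of independent sets form the same set of numbers, so the
  suprema agree.\<close>

lemma zdim_zeros:
  fixes I :: "('n::finite) fn set"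
  assumes I: "poly_ideal I"
  shows "zdim (zeros I) = Sup (card ` {S. independent_coords I S})"
proof -
  have "{k. \<exists>Z. closed_chain (zeros I) k Z} = card ` {S. independent_coords I S}"
    using chain_of_independent_coords[OF I] independent_coords_of_chain[OF I] by blast
  then show ?thesis unfolding zdim_def closed_chain_def by simp
qed


section \<open>Regular functions and iterated derivations\<close>

definition restriction :: "('n::finite) pt set \<Rightarrow> 'n fn \<Rightarrow> 'n fn" where
  "restriction X p = (\<lambda>x. if x \<in> X then p x else 0)"

lemma regular_iff: "f \<in> regular X \<longleftrightarrow> (\<exists>p\<in>poly_fun. f = restriction X p)"
  by (auto simp: regular_def restriction_def)

lemma restriction_regular [intro]: "p \<in> poly_fun \<Longrightarrow> restriction X p \<in> regular X"
  by (auto simp: regular_iff)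

lemma restriction_add: "restriction X (\<lambda>x. p x + q x) = (\<lambda>x. restriction X p x + restriction X q x)"
  and restriction_mult: "restriction X (\<lambda>x. p x * q x) = (\<lambda>x. restriction X p x * restriction X q x)"
  and restriction_zero: "restriction X (\<lambda>x. 0) = (\<lambda>x. 0)"
  and restriction_apply: "x \<in> X \<Longrightarrow> restriction X p x = p x"
  by (auto simp: restriction_def)

lemma restriction_combination:
  "restriction X (\<lambda>x. \<Sum>t\<in>T. u t * p t x) = (\<lambda>x. \<Sum>t\<in>T. u t * restriction X (p t) x)"
  by (auto simp: restriction_def)

lemma regular_add: "f \<in> regular X \<Longrightarrow> g \<in> regular X \<Longrightarrow> (\<lambda>x. f x + g x) \<in> regular X"
  using restriction_regular[OF pf_add, of _ _ X] by (auto simp: regular_iff restriction_add)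

lemma regular_mult: "f \<in> regular X \<Longrightarrow> g \<in> regular X \<Longrightarrow> (\<lambda>x. f x * g x) \<in> regular X"
  using restriction_regular[OF pf_mult, of _ _ X] by (auto simp: regular_iff restriction_mult)

lemma regular_zero: "(\<lambda>x. 0) \<in> regular X"
  using restriction_regular[OF pf_const[of 0], of X] by (simp add: restriction_zero)

lemma regular_scale:
  assumes "f \<in> regular X"
  shows "(\<lambda>x. c * f x) \<in> regular X"
proof -
  obtain p where p: "p \<in> poly_fun" "f = restriction X p" using assms by (auto simp: regular_iff)
  have "(\<lambda>x. c * f x) = restriction X (\<lambda>x. c * p x)" by (auto simp: p(2) restriction_def)
  then show ?thesis using p(1) by (auto intro: poly_fun_scale)
qed

lemma regular_combination:
  "(\<And>t. t \<in> T \<Longrightarrow> f t \<in> regular X) \<Longrightarrow> (\<lambda>x. \<Sum>t\<in>T. u t * f t x) \<in> regular X"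
proof (induction T rule: infinite_finite_induct)
  case (insert t T)
  then show ?case
    using regular_add[of "\<lambda>x. u t * f t x" X "\<lambda>x. \<Sum>t\<in>T. u t * f t x"] regular_scale by auto
qed (auto intro: regular_zero)

lemma derivationD:
  assumes "derivation X D"
  shows derivation_regular: "\<And>f. f \<in> regular X \<Longrightarrow> D f \<in> regular X"
    and derivation_add: "\<And>f g. f \<in> regular X \<Longrightarrow> g \<in> regular X \<Longrightarrow>
      D (\<lambda>x. f x + g x) = (\<lambda>x. D f x + D g x)"
    and derivation_scale: "\<And>c f. f \<in> regular X \<Longrightarrow> D (\<lambda>x. c * f x) = (\<lambda>x. c * D f x)"
    and derivation_mult: "\<And>f g. f \<in> regular X \<Longrightarrow> g \<in> regular X \<Longrightarrow>
      D (\<lambda>x. f x * g x) = (\<lambda>x. f x * D g x + g x * D f x)"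
  using assms by (simp_all add: derivation_def)

section \<open>Iterated derivatives and the invariant ideal\<close>

text \<open>The head of the word acts first, so words applied to \<open>D f\<close> are the words
  with head \<open>D\<close> applied to \<open>f\<close>.\<close>

primrec apply_word :: "('n fn \<Rightarrow> 'n fn) list \<Rightarrow> ('n::finite) fn \<Rightarrow> 'n fn" where
  "apply_word [] f = f"
| "apply_word (D # w) f = apply_word w (D f)"

text \<open>The preimage of I(F,x) in the ring of polynomial functions when \<open>F\<close>
  consists of derivations; the dimension is computed there.\<close>

definition pullback_ideal ::
    "('n::finite) pt set \<Rightarrow> ('n fn \<Rightarrow> 'n fn) set \<Rightarrow> 'n pt \<Rightarrow> 'n fn set" where
  "pullback_ideal X F x = {p \<in> poly_fun. \<forall>w\<in>lists F. apply_word w (restriction X p) x = 0}"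

context
  fixes X :: "('n::finite) pt set" and F :: "('n fn \<Rightarrow> 'n fn) set"
  assumes derivations: "\<And>D. D \<in> F \<Longrightarrow> derivation X D"
begin

lemma apply_word_regular:
  "w \<in> lists F \<Longrightarrow> f \<in> regular X \<Longrightarrow> apply_word w f \<in> regular X"
  by (induction w arbitrary: f) (auto simp: derivation_regular[OF derivations])

lemma apply_word_add:
  "w \<in> lists F \<Longrightarrow> f \<in> regular X \<Longrightarrow> g \<in> regular X \<Longrightarrow>
    apply_word w (\<lambda>x. f x + g x) = (\<lambda>x. apply_word w f x + apply_word w g x)"
proof (induction w arbitrary: f g)
  case (Cons D w)
  then have D: "D \<in> F" "w \<in> lists F" by auto
  show ?case
    using Cons.IH[OF D(2) derivation_regular[OF derivations[OF D(1)] Cons.prems(2)]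
        derivation_regular[OF derivations[OF D(1)] Cons.prems(3)]]
    by (simp add: derivation_add[OF derivations[OF D(1)] Cons.prems(2,3)])
qed simp

lemma apply_word_scale:
  "w \<in> lists F \<Longrightarrow> f \<in> regular X \<Longrightarrow> apply_word w (\<lambda>x. c * f x) = (\<lambda>x. c * apply_word w f x)"
proof (induction w arbitrary: f)
  case (Cons D w)
  then have D: "D \<in> F" "w \<in> lists F" by auto
  show ?case
    using Cons.IH[OF D(2) derivation_regular[OF derivations[OF D(1)] Cons.prems(2)]]
    by (simp add: derivation_scale[OF derivations[OF D(1)] Cons.prems(2)])
qed simp

lemma apply_word_zero: "w \<in> lists F \<Longrightarrow> apply_word w (\<lambda>x. 0) = (\<lambda>x. 0)"
  using apply_word_scale[OF _ regular_zero, of w 0] by simp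

lemma apply_word_combination:
  assumes w: "w \<in> lists F"
  shows "(\<And>t. t \<in> T \<Longrightarrow> f t \<in> regular X) \<Longrightarrow>
    apply_word w (\<lambda>x. \<Sum>t\<in>T. u t * f t x) = (\<lambda>x. \<Sum>t\<in>T. u t * apply_word w (f t) x)"
proof (induction T rule: infinite_finite_induct)
  case (insert t T)
  have "apply_word w (\<lambda>x. u t * f t x + (\<Sum>t\<in>T. u t * f t x))
      = (\<lambda>x. apply_word w (\<lambda>x. u t * f t x) x + apply_word w (\<lambda>x. \<Sum>t\<in>T. u t * f t x) x)"
    using insert.prems by (intro apply_word_add[OF w] regular_scale regular_combination) auto
  moreover have "apply_word w (\<lambda>x. u t * f t x) = (\<lambda>x. u t * apply_word w (f t) x)"
    using insert.prems by (intro apply_word_scale[OF w]) auto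
  moreover have "apply_word w (\<lambda>x. \<Sum>t\<in>T. u t * f t x) = (\<lambda>x. \<Sum>t\<in>T. u t * apply_word w (f t) x)"
    using insert.prems by (intro insert.IH) auto
  ultimately show ?case using insert.hyps by simp
qed (auto simp: apply_word_zero[OF w])

text \<open>By the Leibniz rule every term of the iterated derivative contains a derivative of
  \<open>f\<close> along some word. The induction runs over all pairs, since one step passes from
  \<open>a\<close>, \<open>f\<close> to \<open>a\<close>, \<open>D f\<close> and to
  \<open>D a\<close>, \<open>f\<close>.\<close>

lemma apply_word_mult_vanish:
  "w \<in> lists F \<Longrightarrow> a \<in> regular X \<Longrightarrow> f \<in> regular X \<Longrightarrow>
    (\<And>v. v \<in> lists F \<Longrightarrow> apply_word v f x = 0) \<Longrightarrow> apply_word w (\<lambda>x. a x * f x) x = 0"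
proof (induction w arbitrary: a f)
  case Nil
  then show ?case using Nil.prems(4)[of "[]"] by simp
next
  case (Cons D w)
  then have D: "D \<in> F" "w \<in> lists F" by auto
  note der = derivations[OF D(1)]
  note reg = derivation_regular[OF der Cons.prems(2)] derivation_regular[OF der Cons.prems(3)]
  have "apply_word w (\<lambda>x. a x * D f x) x = 0"
    using Cons.prems(4)[of "D # _"] D by (intro Cons.IH Cons.prems reg) auto
  moreover have "apply_word w (\<lambda>x. D a x * f x) x = 0"
    by (intro Cons.IH Cons.prems reg D)
  moreover have "apply_word w (\<lambda>x. a x * D f x + D a x * f x)
      = (\<lambda>x. apply_word w (\<lambda>x. a x * D f x) x + apply_word w (\<lambda>x. D a x * f x) x)"
    by (intro apply_word_add D regular_mult reg Cons.prems)
  moreover have "D (\<lambda>x. a x * f x) = (\<lambda>x. a x * D f x + D a x * f x)"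
    by (simp add: derivation_mult[OF der Cons.prems(2,3)] mult.commute)
  ultimately show ?case by simp
qed

text \<open>An invariant ideal of functions vanishing at \<open>x\<close> is closed under all words,
  and conversely the functions whose derivatives along all words vanish at \<open>x\<close> form
  such an ideal.\<close>

lemma inv_ideal_iff:
  "f \<in> inv_ideal X F {x} \<longleftrightarrow> f \<in> regular X \<and> (\<forall>w\<in>lists F. apply_word w f x = 0)"
proof
  assume "f \<in> inv_ideal X F {x}"
  then obtain I where I: "reg_ideal X I" "I \<subseteq> van_ideal X {x}" "\<forall>D\<in>F. D ` I \<subseteq> I" and f: "f \<in> I"
    unfolding inv_ideal_def by auto
  have "apply_word w g \<in> I" if "w \<in> lists F" "g \<in> I" for w g
    using that I(3) by (induction w arbitrary: g) auto
  then show "f \<in> regular X \<and> (\<forall>w\<in>lists F. apply_word w f x = 0)"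
    using I(2) f unfolding van_ideal_def by blast
next
  assume f: "f \<in> regular X \<and> (\<forall>w\<in>lists F. apply_word w f x = 0)"
  let ?J = "{f \<in> regular X. \<forall>w\<in>lists F. apply_word w f x = 0}"
  have "reg_ideal X ?J"
    unfolding reg_ideal_def
  proof (intro conjI ballI)
    show "?J \<subseteq> regular X" by blast
    show "(\<lambda>x. 0) \<in> ?J" by (simp add: regular_zero apply_word_zero)
    show "(\<lambda>x. g x + h x) \<in> ?J" if "g \<in> ?J" "h \<in> ?J" for g h
      using that by (auto simp: regular_add apply_word_add)
    show "(\<lambda>x. a x * g x) \<in> ?J" if "a \<in> regular X" "g \<in> ?J" for a g
      using that by (auto simp: regular_mult apply_word_mult_vanish)
  qed
  moreover have "?J \<subseteq> van_ideal X {x}"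
  proof
    fix g assume g: "g \<in> ?J"
    then have "apply_word [] g x = 0" by blast
    then show "g \<in> van_ideal X {x}" using g by (simp add: van_ideal_def)
  qed
  moreover have "D g \<in> ?J" if D: "D \<in> F" and g: "g \<in> ?J" for D g
  proof -
    have gJ: "\<forall>w\<in>lists F. apply_word w g x = 0" using g by simp
    have "apply_word w (D g) x = 0" if "w \<in> lists F" for w
      using bspec[OF gJ, of "D # w"] D that by simp
    then show ?thesis using g derivation_regular[OF derivations[OF D]] by simp
  qed
  then have "\<forall>D\<in>F. D ` ?J \<subseteq> ?J" by blast
  ultimately have "?J \<subseteq> inv_ideal X F {x}" unfolding inv_ideal_def by (intro Union_upper) simp
  then show "f \<in> inv_ideal X F {x}" using f by blast
qed

lemma poly_ideal_pullback: "poly_ideal (pullback_ideal X F x)"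
  unfolding poly_ideal_def
proof (intro conjI ballI)
  show "pullback_ideal X F x \<subseteq> poly_fun" by (auto simp: pullback_ideal_def)
  show "(\<lambda>x. 0) \<in> pullback_ideal X F x"
    by (simp add: pullback_ideal_def pf_const restriction_zero apply_word_zero)
  show "(\<lambda>x. p x + q x) \<in> pullback_ideal X F x" if "p \<in> pullback_ideal X F x" "q \<in> pullback_ideal X F x" for p q
    using that by (auto simp: pullback_ideal_def restriction_add apply_word_add restriction_regular pf_add)
  show "(\<lambda>x. p x * q x) \<in> pullback_ideal X F x" if "p \<in> poly_fun" "q \<in> pullback_ideal X F x" for p q
    using that by (auto simp: pullback_ideal_def restriction_mult apply_word_mult_vanish
        restriction_regular pf_mult)
qed

text \<open>Equations of \<open>X\<close> restrict to zero and so belong to the pulled back ideal;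
  this keeps its zeros inside \<open>X\<close>.\<close>

lemma zeros_pullback:
  assumes X: "zariski_closed X"
  shows "zeros (pullback_ideal X F x) = min_inv_variety X F {x}"
proof (intro equalityI subsetI)
  fix y assume y: "y \<in> zeros (pullback_ideal X F x)"
  obtain P where P: "P \<subseteq> poly_fun" "X = {x. \<forall>p\<in>P. p x = 0}" using X by (auto simp: zariski_closed_def)
  have "p \<in> pullback_ideal X F x" if "p \<in> P" for p
  proof -
    have "restriction X p = (\<lambda>x. 0)" using P that by (auto simp: restriction_def)
    moreover have "p \<in> poly_fun" using P(1) that by blast
    ultimately show ?thesis by (simp add: pullback_ideal_def apply_word_zero)
  qed
  then have "y \<in> X" using y P(2) by (auto simp: zeros_def)
  moreover have "f y = 0" if f: "f \<in> inv_ideal X F {x}" for f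
  proof -
    obtain p where p: "p \<in> poly_fun" "f = restriction X p"
      using f by (auto simp: inv_ideal_iff regular_iff)
    then have "p \<in> pullback_ideal X F x" using f by (auto simp: inv_ideal_iff pullback_ideal_def)
    then show ?thesis using y p(2) \<open>y \<in> X\<close> by (auto simp: zeros_def restriction_apply)
  qed
  ultimately show "y \<in> min_inv_variety X F {x}" by (simp add: min_inv_variety_def)
next
  fix y assume y: "y \<in> min_inv_variety X F {x}"
  have "p y = 0" if p: "p \<in> pullback_ideal X F x" for p
  proof -
    have "restriction X p \<in> inv_ideal X F {x}"
      using p by (auto simp: inv_ideal_iff pullback_ideal_def)
    then have "restriction X p y = 0" "y \<in> X" using y by (auto simp: min_inv_variety_def)
    then show ?thesis by (simp add: restriction_apply)
  qed
  then show "y \<in> zeros (pullback_ideal X F x)" by (simp add: zeros_def)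
qed

text \<open>The only monomial is 1, and the empty word shows that members of the ideal vanish at
  \<open>x\<close>. So some independent set always exists.\<close>

lemma independent_coords_empty:
  assumes "x \<in> X"
  shows "independent_coords (pullback_ideal X F x) {}"
  unfolding independent_coords_def
proof (intro allI impI ballI)
  fix N and u :: "('n \<Rightarrow> nat) \<Rightarrow> complex" and a :: "'n \<Rightarrow> nat"
  assume mem: "(\<lambda>x. \<Sum>a\<in>level_on {} N. u a * monomial_fun a x) \<in> pullback_ideal X F x"
    and a: "a \<in> level_on {} N"
  have a0: "a = (\<lambda>i. 0)" using a by (auto simp: level_on_def)
  have "level_on {} N = {a}" using a by (auto simp: level_on_def)
  moreover have "p x = 0" if "p \<in> pullback_ideal X F x" for p
  proof -
    have "\<forall>w\<in>lists F. apply_word w (restriction X p) x = 0" using that by (simp add: pullback_ideal_def)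
    from bspec[OF this, of "[]"] show ?thesis using assms by (simp add: restriction_apply)
  qed
  ultimately have "u a * monomial_fun a x = 0" using mem by fastforce
  then show "u a = 0" by (simp add: a0)
qed

end

section \<open>Openness and measurability\<close>

text \<open>Elimination with polynomial entries: each unknown gets a pivot that is nonzero at
  \<open>x0\<close>, and \<open>g\<close> is the product of the pivots. Only finitely many rows
  serve as pivots, so \<open>W\<close> may be infinite.\<close>

lemma trivial_kernel_open:
  fixes r :: "'w \<Rightarrow> 'b \<Rightarrow> ('n::finite) fn"
  assumes "finite B" "\<And>w b. w \<in> W \<Longrightarrow> b \<in> B \<Longrightarrow> r w b \<in> poly_fun"
    and "\<And>u. (\<And>w. w \<in> W \<Longrightarrow> (\<Sum>b\<in>B. u b * r w b x0) = 0) \<Longrightarrow> \<forall>b\<in>B. u b = 0"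
  shows "\<exists>g\<in>poly_fun. g x0 \<noteq> 0 \<and> (\<forall>x. g x \<noteq> 0 \<longrightarrow>
    (\<forall>u. (\<forall>w\<in>W. (\<Sum>b\<in>B. u b * r w b x) = 0) \<longrightarrow> (\<forall>b\<in>B. u b = 0)))"
  using assms
proof (induction B arbitrary: r rule: finite_induct)
  case empty
  show ?case by (intro bexI[of _ "\<lambda>x. 1"] pf_const) auto
next
  case (insert b B)
  \<comment> \<open>Otherwise the unit vector at \<open>b\<close> would be in the kernel at
    \<open>x0\<close>.\<close>
  have "\<exists>w\<in>W. r w b x0 \<noteq> 0"
  proof (rule ccontr)
    assume none: "\<not> ?thesis"
    have "(\<Sum>c\<in>insert b B. (if c = b then 1 else 0) * r w c x0) = 0" if "w \<in> W" for w
    proof -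
      have "(\<Sum>c\<in>B. (if c = b then 1 else 0) * r w c x0) = 0"
        using insert.hyps by (intro sum.neutral) auto
      then show ?thesis using insert.hyps none that by simp
    qed
    from insert.prems(2)[of "\<lambda>c. if c = b then 1 else 0", OF this] show False by simp
  qed
  then obtain w0 where w0: "w0 \<in> W" "r w0 b x0 \<noteq> 0" by blast
  \<comment> \<open>Cross-multiplied instead of divided, so the reduced entries stay
    polynomial.\<close>
  define r' where "r' w c = (\<lambda>x. r w0 b x * r w c x - r w b x * r w0 c x)" for w c
  have expand: "(\<Sum>c\<in>B. u c * r' w c x)
      = r w0 b x * (\<Sum>c\<in>B. u c * r w c x) - r w b x * (\<Sum>c\<in>B. u c * r w0 c x)" for u w x
    by (simp add: r'_def right_diff_distrib sum_subtractf sum_distrib_left mult_ac)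
  have "\<exists>g\<in>poly_fun. g x0 \<noteq> 0 \<and> (\<forall>x. g x \<noteq> 0 \<longrightarrow>
    (\<forall>u. (\<forall>w\<in>W. (\<Sum>c\<in>B. u c * r' w c x) = 0) \<longrightarrow> (\<forall>c\<in>B. u c = 0)))"
  proof (rule insert.IH)
    show "r' w c \<in> poly_fun" if "w \<in> W" "c \<in> B" for w c
      unfolding r'_def using that w0(1)
      by (intro poly_fun_diff pf_mult insert.prems(1)) auto
    show "\<forall>c\<in>B. u c = 0" if ker: "\<And>w. w \<in> W \<Longrightarrow> (\<Sum>c\<in>B. u c * r' w c x0) = 0" for u
    proof -
      define s where "s = - (\<Sum>c\<in>B. u c * r w0 c x0) / r w0 b x0"
      have "(\<Sum>c\<in>insert b B. (u(b := s)) c * r w c x0) = 0" if "w \<in> W" for w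
      proof -
        have "(\<Sum>c\<in>insert b B. (u(b := s)) c * r w c x0) = s * r w b x0 + (\<Sum>c\<in>B. u c * r w c x0)"
          using insert.hyps by (simp add: sum.insert_if) (intro sum.cong, auto)
        moreover have "r w0 b x0 * (s * r w b x0 + (\<Sum>c\<in>B. u c * r w c x0)) = 0"
          using ker[OF that] w0(2) unfolding expand s_def by (simp add: field_simps)
        ultimately show ?thesis using w0(2) by simp
      qed
      from insert.prems(2)[of "u(b := s)", OF this] show ?thesis
        using insert.hyps by (metis fun_upd_other insertCI)
    qed
  qed
  then obtain g where g: "g \<in> poly_fun" "g x0 \<noteq> 0"
    and ker: "\<And>x u. g x \<noteq> 0 \<Longrightarrow> \<forall>w\<in>W. (\<Sum>c\<in>B. u c * r' w c x) = 0 \<Longrightarrow> \<forall>c\<in>B. u c = 0" by blast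
  show ?case
  proof (intro bexI[of _ "\<lambda>x. g x * r w0 b x"] conjI allI impI)
    show "(\<lambda>x. g x * r w0 b x) \<in> poly_fun" using w0 g insert.prems(1) by (intro pf_mult) auto
    show "g x0 * r w0 b x0 \<noteq> 0" using g w0 by simp
  next
    fix x u
    assume nz: "g x * r w0 b x \<noteq> 0" and "\<forall>w\<in>W. (\<Sum>c\<in>insert b B. u c * r w c x) = 0"
    then have eq: "(\<Sum>c\<in>B. u c * r w c x) = - (u b * r w b x)" if "w \<in> W" for w
      using that insert.hyps by (simp add: eq_neg_iff_add_eq_0 add.commute)
    have "\<forall>w\<in>W. (\<Sum>c\<in>B. u c * r' w c x) = 0" unfolding expand using w0(1) by (simp add: eq)
    then have B0: "\<forall>c\<in>B. u c = 0" using ker[of x u] nz by simp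
    then have "u b * r w0 b x = 0" using eq[OF w0(1)] by simp
    then show "\<forall>c\<in>insert b B. u c = 0" using nz B0 by simp
  qed
qed

text \<open>A union of basic open sets: the complement is cut out by all \<open>g\<close> whose
  nonvanishing at a point of \<open>X\<close> implies membership in \<open>U\<close>.\<close>

lemma zariski_opensI:
  assumes "\<And>x0. x0 \<in> U \<Longrightarrow> \<exists>g\<in>poly_fun. g x0 \<noteq> 0 \<and> (\<forall>x\<in>X. g x \<noteq> 0 \<longrightarrow> x \<in> U)" "U \<subseteq> X"
  shows "U \<in> zariski_opens X"
proof -
  let ?P = "{g \<in> poly_fun. \<forall>x\<in>X. g x \<noteq> 0 \<longrightarrow> x \<in> U}"
  have "U = X - {x. \<forall>g\<in>?P. g x = 0}" using assms by blast
  moreover have "zariski_closed {x. \<forall>g\<in>?P. g x = 0}" unfolding zariski_closed_def by blast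
  ultimately show ?thesis unfolding zariski_opens_def by blast
qed

text \<open>\<open>d\<close> is the largest size of an \<open>S\<close> all of whose conditions hold
  at the point, so its level sets are finite Boolean combinations of countable intersections of open
  sets.\<close>

lemma dimension_strata:
  fixes G :: "('n::finite) set \<Rightarrow> nat \<Rightarrow> 'n pt set" and X :: "'n pt set"
  assumes X: "X \<noteq> {}" and G: "\<And>S N. G S N \<in> zariski_opens X"
    and empty: "\<And>x N. x \<in> X \<Longrightarrow> x \<in> G {} N"
    and d: "\<And>x. x \<in> X \<Longrightarrow> d x = Sup (card ` {S. \<forall>N. x \<in> G S N})"
  shows "zariski_measurable X d \<and> (\<exists>p. (\<forall>x\<in>X. d x \<le> p) \<and> very_generic X (\<lambda>x. d x = p))"
proof -
  have G_sub: "G S N \<subseteq> X" for S N using G[of S N] by (auto simp: zariski_opens_def)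
  have d_ge: "card S \<le> d x" if "x \<in> X" "\<forall>N. x \<in> G S N" for x S
    using that d by (auto intro: cSup_upper)
  have d_ex: "\<exists>S. card S = d x \<and> (\<forall>N. x \<in> G S N)" if "x \<in> X" for x
  proof -
    have "{S. \<forall>N. x \<in> G S N} \<noteq> {}" using empty[OF that] by blast
    then have "d x = Max (card ` {S. \<forall>N. x \<in> G S N})" using d[OF that] by (simp add: cSup_eq_Max)
    moreover have "Max (card ` {S. \<forall>N. x \<in> G S N}) \<in> card ` {S. \<forall>N. x \<in> G S N}"
      using \<open>{S. \<forall>N. x \<in> G S N} \<noteq> {}\<close> by (intro Max_in) auto
    ultimately show ?thesis by auto
  qed
  interpret sigma_algebra X "sigma_sets X (zariski_opens X)"
    by (rule sigma_algebra_sigma_sets) (auto simp: zariski_opens_def)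
  have "{x \<in> X. d x = k} \<in> sigma_sets X (zariski_opens X)" for k
  proof -
    have "{x \<in> X. d x = k} = (\<Union>S\<in>{S. card S = k}. \<Inter>N. G S N) - (\<Union>S\<in>{S. card S > k}. \<Inter>N. G S N)"
      (is "?L = ?A - ?B")
    proof (intro equalityI subsetI)
      fix x assume x: "x \<in> ?L"
      then obtain S where "card S = d x" "\<forall>N. x \<in> G S N" using d_ex by blast
      then have "x \<in> ?A" using x by auto
      moreover have "x \<notin> ?B" using x d_ge by fastforce
      ultimately show "x \<in> ?A - ?B" by blast
    next
      fix x assume x: "x \<in> ?A - ?B"
      then obtain S where S: "card S = k" "\<forall>N. x \<in> G S N" by blast
      then have "x \<in> X" using G_sub by blast
      then have "k \<le> d x" using d_ge S by blast
      moreover obtain T where T: "card T = d x" "\<forall>N. x \<in> G T N" using d_ex \<open>x \<in> X\<close> by blast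
      have "\<not> k < d x"
      proof
        assume "k < d x"
        then have "x \<in> ?B" using T by (intro UN_I[of T]) auto
        then show False using x by blast
      qed
      ultimately show "x \<in> ?L" using \<open>x \<in> X\<close> by simp
    qed
    moreover have "(\<Inter>N. G S N) \<in> sigma_sets X (zariski_opens X)" for S
      using G by (intro countable_INT) auto
    then have "?A \<in> sigma_sets X (zariski_opens X)" "?B \<in> sigma_sets X (zariski_opens X)"
      by (auto intro!: finite_UN)
    ultimately show ?thesis by (simp add: Diff)
  qed
  then have "zariski_measurable X d" by (simp add: zariski_measurable_def)
  \<comment> \<open>Asking each \<open>G S N\<close> to be nonempty separately, without a common
    point, still bounds \<open>d\<close>; an \<open>S\<close> of maximal size supplies the countable
    family on whose intersection \<open>d\<close> is at least \<open>p\<close>.\<close>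
  moreover define p where "p = Max (card ` {S. \<forall>N. G S N \<noteq> {}})"
  have "d x \<le> p" if x: "x \<in> X" for x
  proof -
    obtain S where S: "card S = d x" "\<forall>N. x \<in> G S N" using d_ex[OF x] by blast
    then have "card S \<in> card ` {S. \<forall>N. G S N \<noteq> {}}" by blast
    then have "card S \<le> p" unfolding p_def by (rule Max_ge[OF finite_imageI[OF finite]])
    then show ?thesis using S(1) by simp
  qed
  moreover have "very_generic X (\<lambda>x. d x = p)"
  proof -
    have "{S. \<forall>N. G S N \<noteq> {}} \<noteq> {}" using X empty by blast
    then have "p \<in> card ` {S. \<forall>N. G S N \<noteq> {}}" unfolding p_def by (intro Max_in) auto
    then obtain S where S: "card S = p" "\<And>N. G S N \<noteq> {}" by blast
    have "d x = p" if "x \<in> X" "\<forall>N. x \<in> G S N" for x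
      using d_ge[OF that] S(1) \<open>\<And>x. x \<in> X \<Longrightarrow> d x \<le> p\<close>[OF that(1)] by simp
    then show ?thesis unfolding very_generic_def
      using G S(2) by (intro exI[of _ "range (G S)"]) auto
  qed
  ultimately show ?thesis by blast
qed

section \<open>Measurability and generic value of the dimension\<close>

theorem theorem1:
  fixes X :: "('n::finite) pt set" and F :: "('n fn \<Rightarrow> 'n fn) set"
  assumes "irreducible_affine_variety X"
    and "algebraic_foliation X F"
  shows "zariski_measurable X (\<lambda>x. zdim (min_inv_variety X F {x}))
    \<and> (\<exists>p::nat. (\<forall>x\<in>X. zdim (min_inv_variety X F {x}) \<le> p)
               \<and> very_generic X (\<lambda>x. zdim (min_inv_variety X F {x}) = p))"
proof -
  have X: "X \<noteq> {}" "zariski_closed X"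
    using assms(1) by (auto simp: irreducible_affine_variety_def zariski_irreducible_def)
  have der: "derivation X D" if "D \<in> F" for D
    using assms(2) that by (auto simp: algebraic_foliation_def)
  let ?I = "pullback_ideal X F"
  \<comment> \<open>Polynomial representatives of the iterated derivatives of monomials turn
    membership in the ideal at \<open>x\<close> into linear equations with coefficients polynomial
    in \<open>x\<close>.\<close>
  have "\<forall>w\<in>lists F. \<forall>a. \<exists>p. p \<in> poly_fun \<and> apply_word w (restriction X (monomial_fun a)) = restriction X p"
    using apply_word_regular[OF der] by (fastforce simp: regular_iff)
  from this[unfolded choice_iff bchoice_iff] obtain r where
    r_all: "\<forall>w\<in>lists F. \<forall>a. r w a \<in> poly_fun \<and> apply_word w (restriction X (monomial_fun a)) = restriction X (r w a)"
    by (elim exE)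
  have r: "r w a \<in> poly_fun" "apply_word w (restriction X (monomial_fun a)) = restriction X (r w a)"
    if "w \<in> lists F" for w a
    using bspec[OF r_all that] by simp_all
  \<comment> \<open>The points of \<open>X\<close> at which the monomials in \<open>S\<close> of
    level \<open>N\<close> are linearly independent modulo the ideal of that point.\<close>
  define G where "G S N = {x \<in> X. \<forall>u. (\<forall>w\<in>lists F. (\<Sum>a\<in>level_on S N. u a * r w a x) = 0) \<longrightarrow>
    (\<forall>a\<in>level_on S N. u a = 0)}" for S N
  have mem_pullback: "(\<lambda>x. \<Sum>a\<in>level_on S N. u a * monomial_fun a x) \<in> ?I x \<longleftrightarrow>
      (\<forall>w\<in>lists F. (\<Sum>a\<in>level_on S N. u a * r w a x) = 0)" if "x \<in> X" for S N u x
  proof -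
    let ?p = "\<lambda>x. \<Sum>a\<in>level_on S N. u a * monomial_fun a x"
    have "apply_word w (restriction X ?p) x = (\<Sum>a\<in>level_on S N. u a * r w a x)" if "w \<in> lists F" for w
      using that \<open>x \<in> X\<close>
      by (simp add: restriction_combination apply_word_combination[OF der] restriction_regular
          monomial_fun_poly_fun r restriction_apply)
    then have "(\<forall>w\<in>lists F. apply_word w (restriction X ?p) x = 0)
        \<longleftrightarrow> (\<forall>w\<in>lists F. (\<Sum>a\<in>level_on S N. u a * r w a x) = 0)"
      by (intro ball_cong) simp_all
    moreover have "?p \<in> poly_fun" by (intro poly_fun_sum poly_fun_scale monomial_fun_poly_fun)
    ultimately show ?thesis by (simp only: pullback_ideal_def mem_Collect_eq simp_thms)
  qed
  have indep_iff: "independent_coords (?I x) S \<longleftrightarrow> (\<forall>N. x \<in> G S N)" if "x \<in> X" for x S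
    unfolding independent_coords_def G_def mem_pullback[OF that] using that by simp
  show ?thesis
  proof (rule dimension_strata[OF X(1)])
    show "G S N \<in> zariski_opens X" for S N
    proof (rule zariski_opensI)
      show "G S N \<subseteq> X" by (auto simp: G_def)
    next
      fix x0 assume x0: "x0 \<in> G S N"
      have "\<exists>g\<in>poly_fun. g x0 \<noteq> 0 \<and> (\<forall>x. g x \<noteq> 0 \<longrightarrow>
        (\<forall>u. (\<forall>w\<in>lists F. (\<Sum>a\<in>level_on S N. u a * r w a x) = 0) \<longrightarrow> (\<forall>a\<in>level_on S N. u a = 0)))"
        using x0 by (intro trivial_kernel_open r) (auto simp: G_def)
      then show "\<exists>g\<in>poly_fun. g x0 \<noteq> 0 \<and> (\<forall>x\<in>X. g x \<noteq> 0 \<longrightarrow> x \<in> G S N)"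
        unfolding G_def by blast
    qed
    show "x \<in> G {} N" if "x \<in> X" for x N
      using independent_coords_empty[OF der that] indep_iff[OF that] by blast
    show "zdim (min_inv_variety X F {x}) = Sup (card ` {S. \<forall>N. x \<in> G S N})" if "x \<in> X" for x
      using zdim_zeros[OF poly_ideal_pullback[OF der]] that
      by (simp add: zeros_pullback[OF der X(2)] indep_iff)
  qed
qed

end
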